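(* Fix $p\ge1$, a finite set $J\subset\mathbb Z$, and a compactly supported continuous piecewise-linear (finitely many breakpoints) seed $g:\mathbb R\to\mathbb R^p$. There exist constants $W,C>0$, depending only on $(p,J,g)$, such that for every $n\ge1$ and every ordered list $\pi$ of $n$ matrix masks $A^{[\pi_1]},\dots,A^{[\pi_n]}$ supported in $J$ (each $A^{[\pi_s]}=(A_j^{[\pi_s]})_{j\in J}$ with arbitrary $A_j^{[\pi_s]}\in\mathbb R^{p\times p}$), there is a one-input, $p$-output ReLU network $\mathcal N_\pi$ with $$\mathcal N_\pi=F_\pi\ \text{on }\mathbb R,\qquad \operatorname{width}(\mathcal N_\pi)\le W,\qquad \operatorname{depth}(\mathcal N_\pi)\le Cn,\qquad \#\operatorname{par}(\mathcal N_\pi)\le Cn,$$ where $F_\pi=V_{\pi_1}\circ\cdots\circ V_{\pi_n}g$.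
   Context: For a mask $A^{[k]}=(A_j^{[k]})_{j\in J}$ the refinement operator is $(V_kf)(x)=\sum_{j\in J}A_j^{[k]}f(2x-j)$; in $V_{\pi_1}\circ\cdots\circ V_{\pi_n}g$ the rightmost operator acts first. A ReLU network consists of affine maps separated by coordinatewise activations $t\mapsto\max\{t,0\}$, with an affine output layer. Width is the largest hidden dimension, depth is the number of hidden (ReLU) layers, and $\#\operatorname{par}$ counts all entries of all affine maps (weights and biases), including zeros. *)

theory Defs
  imports "HOL-Analysis.Elementary_Topology" "Jordan_Normal_Form.Matrix"
begin

text \<open>Elements of \<open>\<real>\<^sup>p\<close> are members of \<open>carrier_vec p\<close>. A matrix mask is a function on the integers
  of which only the values on the index set \<open>J\<close> are used.\<close>

definition refinement_op ::
    "nat \<Rightarrow> int set \<Rightarrow> (int \<Rightarrow> real mat) \<Rightarrow> (real \<Rightarrow> real vec) \<Rightarrow> real \<Rightarrow> real vec" where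
  "refinement_op p J A f x = vec p (\<lambda>i. \<Sum>j\<in>J. (A j *\<^sub>v f (2 * x - real_of_int j)) $ i)"

definition continuous_vec_fun :: "nat \<Rightarrow> (real \<Rightarrow> real vec) \<Rightarrow> bool" where
  "continuous_vec_fun p f \<longleftrightarrow> (\<forall>i<p. continuous_on UNIV (\<lambda>x. f x $ i))"

definition compactly_supported :: "nat \<Rightarrow> (real \<Rightarrow> real vec) \<Rightarrow> bool" where
  "compactly_supported p f \<longleftrightarrow> compact (closure {x. f x \<noteq> 0\<^sub>v p})"

text \<open>\<open>B\<close> is the set of breakpoints; connected subsets of the line are exactly the (bounded or
  unbounded) intervals.\<close>

definition piecewise_linear :: "nat \<Rightarrow> (real \<Rightarrow> real vec) \<Rightarrow> bool" where
  "piecewise_linear p f \<longleftrightarrow>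
    (\<exists>B. finite B \<and>
      (\<forall>I. connected I \<and> I \<inter> B = {} \<longrightarrow>
        (\<exists>u\<in>carrier_vec p. \<exists>v\<in>carrier_vec p. \<forall>x\<in>I. f x = u + x \<cdot>\<^sub>v v)))"

type_synonym affine_map = "real mat \<times> real vec"

fun affine_apply :: "affine_map \<Rightarrow> real vec \<Rightarrow> real vec" where
  "affine_apply (M, b) x = M *\<^sub>v x + b"

fun affine_dims :: "nat \<Rightarrow> nat \<Rightarrow> affine_map \<Rightarrow> bool" where
  "affine_dims m d (M, b) \<longleftrightarrow> M \<in> carrier_mat d m \<and> b \<in> carrier_vec d"

fun affine_out_dim :: "affine_map \<Rightarrow> nat" where
  "affine_out_dim (M, b) = dim_row M"

fun affine_num_params :: "affine_map \<Rightarrow> nat" where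
  "affine_num_params (M, b) = dim_row M * dim_col M + dim_vec b"

definition relu :: "real vec \<Rightarrow> real vec" where
  "relu v = map_vec (\<lambda>t. max t 0) v"

text \<open>\<open>Hidden a N\<close> applies the affine map \<open>a\<close>, then the activation, then the rest \<open>N\<close> of the
  network.\<close>

datatype relu_net = Output affine_map | Hidden affine_map relu_net

fun net_eval :: "relu_net \<Rightarrow> real vec \<Rightarrow> real vec" where
  "net_eval (Output a) x = affine_apply a x"
| "net_eval (Hidden a N) x = net_eval N (relu (affine_apply a x))"

text \<open>\<open>net_dims m k N\<close>: the dimensions of consecutive layers of \<open>N\<close> match, and \<open>N\<close> has \<open>m\<close> inputs
  and \<open>k\<close> outputs. Hidden layers are nonempty.\<close>

fun net_dims :: "nat \<Rightarrow> nat \<Rightarrow> relu_net \<Rightarrow> bool" where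
  "net_dims m k (Output a) \<longleftrightarrow> affine_dims m k a"
| "net_dims m k (Hidden a N) \<longleftrightarrow> (\<exists>d>0. affine_dims m d a \<and> net_dims d k N)"

fun net_width :: "relu_net \<Rightarrow> nat" where
  "net_width (Output a) = 0"
| "net_width (Hidden a N) = max (affine_out_dim a) (net_width N)"

fun net_depth :: "relu_net \<Rightarrow> nat" where
  "net_depth (Output a) = 0"
| "net_depth (Hidden a N) = Suc (net_depth N)"

fun net_num_params :: "relu_net \<Rightarrow> nat" where
  "net_num_params (Output a) = affine_num_params a"
| "net_num_params (Hidden a N) = affine_num_params a + net_num_params N"

end

theory Submission
  imports Defs "HOL-Analysis.Elementary_Metric_Spaces"
begin

text \<open>
  The seed is a sum of scalar hats supported in intervals of length \<open>1 / 2\<close>. Translating the seed by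
  \<open>s\<close> translates \<open>F\<^sub>\<pi>\<close> by \<open>s / 2\<^sup>n\<close>, so a single hat \<open>\<phi>\<close> supported in \<open>[1/4, 3/4]\<close> suffices. For it,
  \<open>F\<^sub>\<pi> x\<close> is a linear combination of the values at \<open>t\<^sub>k + l\<close>, \<open>l\<close> in a fixed finite set, of the function
  produced by the last \<open>n - k\<close> masks, where \<open>t\<^sub>k\<close> is the fractional part of \<open>2\<^sup>k x\<close>. The coefficients
  \<open>q\<^sub>k\<close> and the products \<open>t\<^sub>k q\<^sub>k\<close> are updated by linear maps selected by the next binary digit of \<open>x\<close>,
  and \<open>q\<^sub>n \<phi> (t\<^sub>n)\<close> is piecewise linear in \<open>(q\<^sub>n, t\<^sub>n q\<^sub>n)\<close>.

  A ReLU network computes the digits exactly only away from short intervals left of the dyadic points.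
  There \<open>2\<^sup>n x\<close> is within \<open>1/8\<close> of an integer, so \<open>F\<^sub>\<pi> x = 0\<close>; the output is clipped to a multiple of
  the excess over \<open>1/8\<close> of the distance from \<open>2\<^sup>n x\<close> to the integers. The tent map computes that distance
  without using digits, and the clipping annihilates whatever the wrong digits have produced.
\<close>

section \<open>Functions computed by a network\<close>

text \<open>Affine combinations cost no layer, because the next affine map absorbs them, so
  functions matter only up to this span. As an inductive set it allows membership proofs by
  introduction rules, without exhibiting coefficients.\<close>

inductive_set affine_span :: "(real \<Rightarrow> real) set \<Rightarrow> (real \<Rightarrow> real) set" for S where
  base: "f \<in> S \<Longrightarrow> f \<in> affine_span S"
| const: "(\<lambda>x. c) \<in> affine_span S"
| add: "f \<in> affine_span S \<Longrightarrow> g \<in> affine_span S \<Longrightarrow> (\<lambda>x. f x + g x) \<in> affine_span S"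
| scale: "f \<in> affine_span S \<Longrightarrow> (\<lambda>x. c * f x) \<in> affine_span S"

lemma affine_span_trans:
  assumes "f \<in> affine_span S" "S \<subseteq> affine_span T"
  shows "f \<in> affine_span T"
  using assms by (induction rule: affine_span.induct) (auto intro: affine_span.intros)

lemma affine_span_uminus: "f \<in> affine_span S \<Longrightarrow> (\<lambda>x. - f x) \<in> affine_span S"
  using affine_span.scale[of f S "-1"] by simp

lemma affine_span_diff:
  "f \<in> affine_span S \<Longrightarrow> g \<in> affine_span S \<Longrightarrow> (\<lambda>x. f x - g x) \<in> affine_span S"
  using affine_span.add[OF _ affine_span_uminus, of f S g] by simp

lemma affine_span_scale_right:
  "f \<in> affine_span S \<Longrightarrow> (\<lambda>x. f x * c) \<in> affine_span S"
  using affine_span.scale[of f S c] by (simp add: mult.commute)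

lemma affine_span_divide:
  "f \<in> affine_span S \<Longrightarrow> (\<lambda>x. f x / c) \<in> affine_span S"
  using affine_span.scale[of f S "1 / c"] by simp

lemma affine_span_sum:
  assumes "\<And>i. i \<in> I \<Longrightarrow> f i \<in> affine_span S"
  shows "(\<lambda>x. \<Sum>i\<in>I. f i x) \<in> affine_span S"
proof (cases "finite I")
  case True
  then show ?thesis
    using assms by (induction I) (auto intro: affine_span.intros)
qed (simp add: affine_span.const)

lemma affine_span_sum_list:
  assumes "\<And>i. i \<in> set is \<Longrightarrow> f i \<in> affine_span S"
  shows "(\<lambda>x. \<Sum>i\<leftarrow>is. f i x) \<in> affine_span S"
  using assms by (induction "is") (auto intro: affine_span.intros)

lemma affine_span_if:
  assumes "P \<Longrightarrow> f \<in> affine_span S" "\<not> P \<Longrightarrow> g \<in> affine_span S"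
  shows "(\<lambda>x. if P then f x else g x) \<in> affine_span S"
  using assms by (cases P) auto

lemmas affine_span_intros =
  affine_span.const affine_span.add affine_span.scale affine_span_uminus affine_span_diff
  affine_span_scale_right affine_span_divide affine_span_sum affine_span_sum_list affine_span_if

text \<open>Recovers explicit coefficients, to be used as a row of a weight matrix and a
  bias.\<close>

lemma affine_span_finite_image:
  assumes "f \<in> affine_span (h ` {..<k::nat})"
  shows "\<exists>a c. \<forall>x. f x = c + (\<Sum>i<k. a i * h i x)"
  using assms
proof (induction rule: affine_span.induct)
  case (base f)
  then obtain j where "j < k" "f = h j" by auto
  then have "\<forall>x. f x = 0 + (\<Sum>i<k. (if i = j then 1 else 0) * h i x)"
    by (simp add: if_distrib[of "\<lambda>a. a * _"] cong: if_cong)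
  then show ?case by (intro exI)
next
  case (const c)
  have "\<forall>x. c = c + (\<Sum>i<k. 0 * h i x)" by simp
  then show ?case by (intro exI)
next
  case (add f g)
  then obtain a c a' c' where "\<forall>x. f x = c + (\<Sum>i<k. a i * h i x)"
    "\<forall>x. g x = c' + (\<Sum>i<k. a' i * h i x)" by blast
  then have "\<forall>x. f x + g x = (c + c') + (\<Sum>i<k. (a i + a' i) * h i x)"
    by (simp add: algebra_simps sum.distrib)
  then show ?case by (intro exI)
next
  case (scale f d)
  then obtain a c where "\<forall>x. f x = c + (\<Sum>i<k. a i * h i x)" by blast
  then have "\<forall>x. d * f x = d * c + (\<Sum>i<k. (d * a i) * h i x)"
    by (simp add: algebra_simps sum_distrib_left)
  then show ?case by (intro exI)
qed

section \<open>Composition and size of networks\<close>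

fun affine_comp :: "affine_map \<Rightarrow> affine_map \<Rightarrow> affine_map" where
  "affine_comp (M', b') (M, b) = (M' * M, M' *\<^sub>v b + b')"

text \<open>The second argument acts first. Its output map is fused with the first affine map of the
  other network, so depths add exactly and the width is the maximum.\<close>

fun net_comp :: "relu_net \<Rightarrow> relu_net \<Rightarrow> relu_net" where
  "net_comp (Output b) (Output a) = Output (affine_comp b a)"
| "net_comp (Hidden b M) (Output a) = Hidden (affine_comp b a) M"
| "net_comp M (Hidden a N) = Hidden a (net_comp M N)"

lemma affine_comp_dims:
  "affine_dims m d a \<Longrightarrow> affine_dims d e b \<Longrightarrow> affine_dims m e (affine_comp b a)"
  by (cases a; cases b) auto

lemma affine_comp_apply:
  assumes "affine_dims m d a" "affine_dims d e b" "x \<in> carrier_vec m"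
  shows "affine_apply (affine_comp b a) x = affine_apply b (affine_apply a x)"
proof -
  obtain M u M' u' where [simp]: "a = (M, u)" "b = (M', u')" by (cases a; cases b) auto
  have "M \<in> carrier_mat d m" "u \<in> carrier_vec d" "M' \<in> carrier_mat e d" "u' \<in> carrier_vec e"
    using assms by auto
  then show ?thesis
    using assms(3)
    by (simp add: mult_add_distrib_mat_vec[where nr=e and nc=d]
        assoc_mult_mat_vec[where n\<^sub>1=e and n\<^sub>2=d and n\<^sub>3=m]
        assoc_add_vec[where n=e])
qed

lemma affine_apply_carrier:
  assumes "affine_dims m d a"
  shows "affine_apply a x \<in> carrier_vec d"
proof -
  obtain M u where a: "a = (M, u)" by (cases a)
  then have "dim_vec u = d" using assms by auto
  then have "dim_vec (affine_apply a x) = d" unfolding a affine_apply.simps index_add_vec(2) .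
  then show ?thesis by (rule carrier_vecI)
qed

lemma relu_carrier [simp]: "v \<in> carrier_vec d \<Longrightarrow> relu v \<in> carrier_vec d"
  by (simp add: relu_def)

lemma net_eval_carrier: "net_dims m k N \<Longrightarrow> net_eval N x \<in> carrier_vec k"
  by (induction N arbitrary: m x) (auto intro: affine_apply_carrier)

lemma net_comp_dims:
  "net_dims m k N \<Longrightarrow> net_dims k l M \<Longrightarrow> net_dims m l (net_comp M N)"
  by (induction M N arbitrary: m rule: net_comp.induct) (auto intro: affine_comp_dims)

lemma net_comp_eval:
  "net_dims m k N \<Longrightarrow> net_dims k l M \<Longrightarrow> x \<in> carrier_vec m \<Longrightarrow>
    net_eval (net_comp M N) x = net_eval M (net_eval N x)"
proof (induction M N arbitrary: m x rule: net_comp.induct)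
  case (1 b a)
  then show ?case using affine_comp_apply[of m k a l b x] by simp
next
  case (2 b M a)
  then obtain d where "affine_dims k d b" by auto
  then show ?case using 2 affine_comp_apply[of m k a d b x] by simp
next
  case (3 M a N)
  then obtain d where d: "d > 0" "affine_dims m d a" "net_dims d k N" by auto
  have "relu (affine_apply a x) \<in> carrier_vec d" using affine_apply_carrier[OF d(2)] by simp
  then show ?case using 3 d by simp
qed

lemma affine_comp_out_dim: "affine_out_dim (affine_comp b a) = affine_out_dim b"
  by (cases a; cases b) auto

lemma net_comp_width: "net_width (net_comp M N) = max (net_width M) (net_width N)"
  by (induction M N rule: net_comp.induct) (auto simp: affine_comp_out_dim)

lemma net_comp_depth: "net_depth (net_comp M N) = net_depth M + net_depth N"
  by (induction M N rule: net_comp.induct) auto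

lemma affine_num_params_eq: "affine_dims m d a \<Longrightarrow> affine_num_params a = d * m + d"
  by (cases a) auto

lemma affine_out_dim_eq: "affine_dims m d a \<Longrightarrow> affine_out_dim a = d"
  by (cases a) auto

text \<open>There are depth plus one affine maps, each between dimensions at most \<open>V\<close>,
  hence with at most \<open>V * V + V\<close> entries.\<close>

lemma net_num_params_le:
  assumes "net_dims m k N" "m \<le> V" "k \<le> V" "net_width N \<le> V"
  shows "net_num_params N \<le> Suc (net_depth N) * (V * V + V)"
  using assms
proof (induction N arbitrary: m)
  case (Output a)
  then show ?case by (simp add: affine_num_params_eq add_mono mult_le_mono)
next
  case (Hidden a N)
  then obtain d where d: "affine_dims m d a" "net_dims d k N" by auto
  then have "d \<le> V" using Hidden.prems by (simp add: affine_out_dim_eq)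
  then have "affine_num_params a \<le> V * V + V"
    using d Hidden.prems by (simp add: affine_num_params_eq add_mono mult_le_mono)
  moreover have "net_num_params N \<le> Suc (net_depth N) * (V * V + V)"
    using Hidden.IH[OF d(2) \<open>d \<le> V\<close>] Hidden.prems by simp
  ultimately show ?case by simp
qed

section \<open>Functions available at a given width and depth\<close>

definition net_outputs :: "relu_net \<Rightarrow> nat \<Rightarrow> real \<Rightarrow> real" where
  "net_outputs N i x = net_eval N (vec 1 (\<lambda>_. x)) $ i"

text \<open>The depth is exact while the width is only bounded: one \<open>W\<close> is fixed for
  the whole construction, and the depths of successive stages add up.\<close>

definition computes :: "nat \<Rightarrow> nat \<Rightarrow> (real \<Rightarrow> real) set \<Rightarrow> bool" where
  "computes W D S \<longleftrightarrow> (\<exists>k N. net_dims 1 k N \<and> net_width N \<le> W \<and> net_depth N = D \<and>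
      S \<subseteq> affine_span (net_outputs N ` {..<k}))"

lemma computes_span:
  assumes "computes W D S" "T \<subseteq> affine_span S"
  shows "computes W D T"
proof -
  obtain k N where "net_dims 1 k N" "net_width N \<le> W" "net_depth N = D"
    "S \<subseteq> affine_span (net_outputs N ` {..<k})"
    using assms(1) unfolding computes_def by blast
  moreover from this have "T \<subseteq> affine_span (net_outputs N ` {..<k})"
    using assms(2) affine_span_trans by blast
  ultimately show ?thesis unfolding computes_def by (intro exI conjI)
qed

lemma computes_id: "computes W 0 {\<lambda>x. x}"
proof -
  let ?N = "Output (1\<^sub>m 1, 0\<^sub>v 1)"
  have "net_outputs ?N 0 = (\<lambda>x. x)"
    by (auto simp: net_outputs_def fun_eq_iff)
  then show ?thesis
    unfolding computes_def
    by (intro exI[of _ 1] exI[of _ ?N]) (auto intro: affine_span.base)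
qed

lemma affine_family_apply:
  assumes "\<And>i. i < d \<Longrightarrow> f i \<in> affine_span (net_outputs N ` {..<k})" "net_dims 1 k N"
  obtains b where "affine_dims k d b"
    "\<And>x. affine_apply b (net_eval N (vec 1 (\<lambda>_. x))) = vec d (\<lambda>i. f i x)"
proof -
  have "\<forall>i. \<exists>a c. i < d \<longrightarrow> (\<forall>x. f i x = c + (\<Sum>j<k. a j * net_outputs N j x))"
    using affine_span_finite_image[OF assms(1)] by blast
  then obtain a c where ac: "\<And>i x. i < d \<Longrightarrow> f i x = c i + (\<Sum>j<k. a i j * net_outputs N j x)"
    by metis
  let ?b = "(mat d k (\<lambda>(i, j). a i j), vec d c)"
  have "affine_apply ?b (net_eval N (vec 1 (\<lambda>_. x))) = vec d (\<lambda>i. f i x)" for x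
  proof
    fix i assume "i < dim_vec (vec d (\<lambda>i. f i x))"
    then have i: "i < d" by simp
    have "dim_vec (net_eval N (vec 1 (\<lambda>_. x))) = k"
      using net_eval_carrier[OF assms(2)] carrier_vecD by blast
    then show "affine_apply ?b (net_eval N (vec 1 (\<lambda>_. x))) $ i = vec d (\<lambda>i. f i x) $ i"
      using i by (simp add: ac scalar_prod_def net_outputs_def atLeast0LessThan)
  qed simp
  then show ?thesis using that[of ?b] by simp
qed

text \<open>To survive the activation, each \<open>f\<close> in \<open>S\<close> is kept as
  \<open>max f 0 - max (- f) 0\<close>. This costs two neurons per element of \<open>S\<close> and
  one per element of \<open>G\<close>. A nonempty \<open>S\<close> makes the hidden layer
  nonempty.\<close>

lemma computes_layer:
  assumes "computes W D S" "finite S" "S \<noteq> {}" "finite G" "G \<subseteq> affine_span S"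
    "2 * card S + card G \<le> W"
  shows "computes W (Suc D) (S \<union> (\<lambda>f x. max (f x) 0) ` G)"
proof -
  obtain k N where N: "net_dims 1 k N" "net_width N \<le> W" "net_depth N = D"
    "S \<subseteq> affine_span (net_outputs N ` {..<k})"
    using assms(1) unfolding computes_def by blast
  let ?T = "S \<union> (\<lambda>f x. - f x) ` S \<union> G"
  have "card ?T \<le> card S + card ((\<lambda>f x. - f x) ` S) + card G"
    by (meson add_le_mono card_Un_le le_refl order_trans)
  also have "\<dots> \<le> 2 * card S + card G"
    using card_image_le[OF assms(2), of "\<lambda>f x. - f x"] by simp
  finally have cT: "card ?T \<le> W" using assms(6) by linarith
  obtain gs where gs: "set gs = ?T" "distinct gs"
    using finite_distinct_list[of ?T] assms by auto
  define d where "d = length gs"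
  have d: "d \<le> W" "d > 0"
    using cT gs assms(3) distinct_card[OF gs(2)] unfolding d_def by auto
  have "?T \<subseteq> affine_span S"
    using assms(5) by (auto intro: affine_span_uminus affine_span.base)
  then have "?T \<subseteq> affine_span (net_outputs N ` {..<k})"
    using N(4) affine_span_trans by blast
  then have "gs ! i \<in> affine_span (net_outputs N ` {..<k})" if "i < d" for i
    using that gs(1) nth_mem unfolding d_def by blast
  from affine_family_apply[of d "\<lambda>i. gs ! i", OF this N(1)]
  obtain b where b: "affine_dims k d b"
    "\<And>x. affine_apply b (net_eval N (vec 1 (\<lambda>_. x))) = vec d (\<lambda>i. (gs ! i) x)" by blast
  define M where "M = Hidden b (Output (1\<^sub>m d, 0\<^sub>v d))"
  have M: "net_dims k d M" "net_width M \<le> W" "net_depth M = 1"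
    using b d by (auto simp: M_def affine_out_dim_eq)
  have out: "net_outputs (net_comp M N) i = (\<lambda>x. max ((gs ! i) x) 0)" if "i < d" for i
  proof
    fix x
    have "net_eval (net_comp M N) (vec 1 (\<lambda>_. x)) = net_eval M (net_eval N (vec 1 (\<lambda>_. x)))"
      using net_comp_eval[OF N(1) M(1)] by simp
    also have "\<dots> = relu (vec d (\<lambda>i. (gs ! i) x))"
      unfolding M_def net_eval.simps b(2) by simp
    finally show "net_outputs (net_comp M N) i x = max ((gs ! i) x) 0"
      using that unfolding net_outputs_def by (simp add: relu_def)
  qed
  let ?O = "net_outputs (net_comp M N) ` {..<d}"
  have relu: "(\<lambda>x. max (f x) 0) \<in> affine_span ?O" if f: "f \<in> ?T" for f
  proof -
    obtain i where i: "i < d" "gs ! i = f"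
      using f unfolding d_def gs(1)[symmetric] in_set_conv_nth by blast
    have "net_outputs (net_comp M N) i \<in> affine_span ?O"
      using i(1) by (intro affine_span.base imageI) simp
    then show ?thesis unfolding out[OF i(1)] i(2) .
  qed
  have "f \<in> affine_span ?O" if "f \<in> S" for f
  proof -
    have "(\<lambda>x. max (f x) 0 - max (- f x) 0) \<in> affine_span ?O"
      using relu[of f] relu[of "\<lambda>x. - f x"] that by (intro affine_span_diff) auto
    moreover have "(\<lambda>x. max (f x) 0 - max (- f x) 0) = f" by (auto simp: fun_eq_iff max_def)
    ultimately show ?thesis by simp
  qed
  then have "S \<union> (\<lambda>f x. max (f x) 0) ` G \<subseteq> affine_span ?O"
    using relu by blast
  moreover have "net_width (net_comp M N) \<le> W" "net_depth (net_comp M N) = Suc D"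
    using N M by (simp_all add: net_comp_width net_comp_depth)
  ultimately show ?thesis
    unfolding computes_def using net_comp_dims[OF N(1) M(1)] by (intro exI conjI)
qed

lemma computes_net:
  assumes "computes W D S" "\<And>i. i < p \<Longrightarrow> f i \<in> affine_span S"
  shows "\<exists>N. net_dims 1 p N \<and> net_width N \<le> W \<and> net_depth N = D \<and>
    (\<forall>x. net_eval N (vec 1 (\<lambda>_. x)) = vec p (\<lambda>i. f i x))"
proof -
  obtain k N where N: "net_dims 1 k N" "net_width N \<le> W" "net_depth N = D"
    "S \<subseteq> affine_span (net_outputs N ` {..<k})"
    using assms(1) unfolding computes_def by blast
  have "f i \<in> affine_span (net_outputs N ` {..<k})" if "i < p" for i
    using affine_span_trans[OF assms(2)[OF that] N(4)] .
  from affine_family_apply[of p f, OF this N(1)]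
  obtain b where b: "affine_dims k p b"
    "\<And>x. affine_apply b (net_eval N (vec 1 (\<lambda>_. x))) = vec p (\<lambda>i. f i x)" by blast
  then have b': "net_dims k p (Output b)" by simp
  show ?thesis
  proof (intro exI conjI allI)
    show "net_dims 1 p (net_comp (Output b) N)" by (rule net_comp_dims[OF N(1) b'])
    show "net_width (net_comp (Output b) N) \<le> W" using N(2) by (simp add: net_comp_width)
    show "net_depth (net_comp (Output b) N) = D" using N(3) by (simp add: net_comp_depth)
    fix x
    have "net_eval (net_comp (Output b) N) (vec 1 (\<lambda>_. x))
        = affine_apply b (net_eval N (vec 1 (\<lambda>_. x)))"
      using net_comp_eval[OF N(1) b'] by simp
    then show "net_eval (net_comp (Output b) N) (vec 1 (\<lambda>_. x)) = vec p (\<lambda>i. f i x)"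
      unfolding b(2) .
  qed
qed

section \<open>Hat functions\<close>

text \<open>The hat with nodes \<open>a\<close>, \<open>b\<close>, \<open>c\<close> and height 1 at
  \<open>b\<close>. In this nested form each of the two maxima can later be multiplied by a
  coefficient through \<open>clip_mult_max\<close>.\<close>

definition hat :: "real \<Rightarrow> real \<Rightarrow> real \<Rightarrow> real \<Rightarrow> real" where
  "hat a b c x = max ((x - a) / (b - a) - (1 / (b - a) + 1 / (c - b)) * max (x - b) 0) 0"

lemma hat_left: "a < b \<Longrightarrow> a \<le> x \<Longrightarrow> x \<le> b \<Longrightarrow> hat a b c x = (x - a) / (b - a)"
  by (simp add: hat_def)

lemma hat_right_slope:
  assumes "a < b" "b < (c :: real)"
  shows "(x - a) / (b - a) - (1 / (b - a) + 1 / (c - b)) * (x - b) = (c - x) / (c - b)"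
proof -
  have "(x - a) / (b - a) = 1 + (x - b) / (b - a)" "(c - x) / (c - b) = 1 - (x - b) / (c - b)"
    using assms by (simp_all add: field_simps)
  then show ?thesis by (simp add: distrib_right)
qed

lemma hat_right:
  assumes "a < b" "b < c" "b \<le> x" "x \<le> c"
  shows "hat a b c x = (c - x) / (c - b)"
  using assms hat_right_slope[of a b c x] by (simp add: hat_def)

lemma hat_eq_0:
  assumes "a < b" "b < c" "x \<le> a \<or> c \<le> x"
  shows "hat a b c x = 0"
  using assms(3)
proof
  assume "x \<le> a"
  then have "(x - a) / (b - a) \<le> 0" using assms by (intro divide_nonpos_pos) auto
  then show ?thesis using assms \<open>x \<le> a\<close> by (simp add: hat_def)
next
  assume x: "c \<le> x"
  have "(c - x) / (c - b) \<le> 0" using x assms by (intro divide_nonpos_pos) auto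
  then show ?thesis using assms x hat_right_slope[of a b c x] by (simp add: hat_def)
qed

lemma hat_le_1:
  assumes "a < b" "b < c"
  shows "hat a b c x \<le> 1"
proof -
  consider "x \<le> a \<or> c \<le> x" | "a \<le> x" "x \<le> b" | "b \<le> x" "x \<le> c" by linarith
  then show ?thesis
    using assms by cases (simp_all add: hat_eq_0 hat_left hat_right)
qed

lemma hat_translate: "hat a b c x = hat (a - s) (b - s) (c - s) (x - s)"
  by (simp add: hat_def)

text \<open>Induction along the nodes: subtracting the hat with peak at the second node, weighted by
  the value of \<open>f\<close> there, leaves a function that vanishes up to that node and is still
  affine between later consecutive nodes. A hat spans two mesh intervals, whence
  \<open>2 * d\<close>.\<close>

lemma hat_decomposition:
  assumes "successively (\<lambda>a b. a < b \<and> b - a \<le> d \<and> (\<exists>u v. \<forall>x\<in>{a..b}. f x = u + x * v)) (z # zs)"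
    and "\<And>x. x \<le> z \<Longrightarrow> f x = 0" "\<And>x. last (z # zs) \<le> x \<Longrightarrow> f x = 0"
  shows "\<exists>hs. (\<forall>(w, a, b, c)\<in>set hs. a < b \<and> b < c \<and> c - a \<le> 2 * d) \<and>
    (\<forall>x. f x = (\<Sum>(w, a, b, c)\<leftarrow>hs. w * hat a b c x))"
  using assms
proof (induction zs arbitrary: z f)
  case Nil
  then have "f x = 0" for x by (cases "x \<le> z") auto
  then show ?case by (intro exI[of _ "[]"]) simp
next
  case (Cons z1 zs)
  have zz: "z < z1" "z1 - z \<le> d" using Cons.prems(1) by auto
  obtain u v where uv: "\<And>x. z \<le> x \<Longrightarrow> x \<le> z1 \<Longrightarrow> f x = u + x * v" using Cons.prems(1) by auto
  have fz: "u + z * v = 0" using Cons.prems(2)[of z] uv[of z] zz by simp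
  show ?case
  proof (cases zs)
    case Nil
    \<comment> \<open>An affine function vanishing at both ends of the only interval is
      zero.\<close>
    have "u + z1 * v = 0" using Cons.prems(3)[of z1] uv[of z1] zz Nil by simp
    then have "(z1 - z) * v = 0" using fz unfolding left_diff_distrib by linarith
    then have "v = 0" "u = 0" using zz fz by auto
    then have "f x = 0" for x
      using Cons.prems(2)[of x] Cons.prems(3)[of x] uv[of x] Nil
      by (cases "x \<le> z"; cases "z1 \<le> x") auto
    then show ?thesis by (intro exI[of _ "[]"]) simp
  next
    case (Cons z2 ws)
    have z2: "z1 < z2" "z2 - z1 \<le> d" using Cons.prems(1) \<open>zs = z2 # ws\<close> by auto
    have "successively (<) (z2 # ws)"
      using Cons.prems(1) unfolding \<open>zs = z2 # ws\<close> by (auto elim: successively_mono)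
    then have "sorted_wrt (<) (z2 # ws)" by (simp add: successively_conv_sorted_wrt)
    then have ge: "y \<ge> z2" if "y \<in> set (z2 # ws)" for y using that by (auto simp: less_imp_le)
    define f' where "f' x = f x - f z1 * hat z z1 z2 x" for x
    have fl: "f' x = 0" if "x \<le> z1" for x
    proof (cases "x \<le> z")
      case True
      then show ?thesis using Cons.prems(2) zz z2 by (simp add: f'_def hat_eq_0)
    next
      case False
      have "u = - (z * v)" using fz by simp
      then have "f z1 = (z1 - z) * v" "f x = (x - z) * v"
        using uv[of z1] uv[of x] zz that False by (auto simp: algebra_simps)
      then show ?thesis using False that zz by (simp add: f'_def hat_left)
    qed
    have fr: "f' x = 0" if "last (z1 # zs) \<le> x" for x
    proof -
      have "z2 \<le> last (z1 # zs)" using ge last_in_set[of "z2 # ws"] \<open>zs = z2 # ws\<close> by simp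
      then show ?thesis using that Cons.prems(3)[of x] zz z2 by (simp add: f'_def hat_eq_0)
    qed
    have fs: "successively (\<lambda>a b. a < b \<and> b - a \<le> d \<and>
        (\<exists>u v. \<forall>x\<in>{a..b}. f' x = u + x * v)) (z1 # zs)"
    proof -
      obtain u v where uv: "\<forall>x\<in>{z1..z2}. f x = u + x * v"
        using Cons.prems(1) \<open>zs = z2 # ws\<close> by auto
      \<comment> \<open>The hat falls here as \<open>(z2 - x) / (z2 - z1)\<close>, which gives the
        new intercept and slope.\<close>
      have "\<forall>x\<in>{z1..z2}. f' x = (u - f z1 * (z2 / (z2 - z1))) + x * (v + f z1 / (z2 - z1))"
        using uv zz z2 by (auto simp: f'_def hat_right diff_divide_distrib algebra_simps)
      then have "\<exists>u v. \<forall>x\<in>{z1..z2}. f' x = u + x * v" by blast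
      moreover have "successively (\<lambda>a b. a < b \<and> b - a \<le> d \<and>
        (\<exists>u v. \<forall>x\<in>{a..b}. f' x = u + x * v)) (z2 # ws)"
      proof (rule successively_mono)
        show "successively (\<lambda>a b. a < b \<and> b - a \<le> d \<and> (\<exists>u v. \<forall>x\<in>{a..b}. f x = u + x * v)) (z2 # ws)"
          using Cons.prems(1) \<open>zs = z2 # ws\<close> by auto
      next
        fix a b
        assume ab: "a \<in> set (z2 # ws)" "b \<in> set (z2 # ws)"
          "a < b \<and> b - a \<le> d \<and> (\<exists>u v. \<forall>x\<in>{a..b}. f x = u + x * v)"
        then have "\<forall>x\<in>{a..b}. f' x = f x"
          using ge[of a] zz z2 by (auto simp: f'_def hat_eq_0)
        then show "a < b \<and> b - a \<le> d \<and> (\<exists>u v. \<forall>x\<in>{a..b}. f' x = u + x * v)"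
          using ab by simp
      qed
      ultimately show ?thesis using z2 \<open>zs = z2 # ws\<close> by simp
    qed
    have "\<exists>hs. (\<forall>(w, a, b, c)\<in>set hs. a < b \<and> b < c \<and> c - a \<le> 2 * d) \<and>
        (\<forall>x. f' x = (\<Sum>(w, a, b, c)\<leftarrow>hs. w * hat a b c x))"
      using fs fl fr by (rule Cons.IH)
    then obtain hs where hs: "(\<forall>(w, a, b, c)\<in>set hs. a < b \<and> b < c \<and> c - a \<le> 2 * d) \<and>
        (\<forall>x. f' x = (\<Sum>(w, a, b, c)\<leftarrow>hs. w * hat a b c x))"
      by (rule exE)
    have "f x = f z1 * hat z z1 z2 x + (\<Sum>(w, a, b, c)\<leftarrow>hs. w * hat a b c x)" for x
      using conjunct2[OF hs, THEN spec, of x] by (simp add: f'_def)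
    then have "\<forall>x. f x = (\<Sum>(w, a, b, c)\<leftarrow>(f z1, z, z1, z2) # hs. w * hat a b c x)"
      unfolding list.map sum_list.Cons prod.case by (rule allI)
    moreover have "\<forall>(w, a, b, c)\<in>set ((f z1, z, z1, z2) # hs). a < b \<and> b < c \<and> c - a \<le> 2 * d"
      using conjunct1[OF hs] zz z2 by simp
    ultimately show ?thesis by (intro exI conjI)
  qed
qed

text \<open>\<open>piecewise_linear\<close> gives affinity only on intervals that avoid the
  breakpoints; continuity carries it to the endpoints.\<close>

lemma affine_on_closed_interval:
  fixes f :: "real \<Rightarrow> real"
  assumes "continuous_on UNIV f" "a < b" "\<And>x. a < x \<Longrightarrow> x < b \<Longrightarrow> f x = u + x * v"
  shows "\<forall>x\<in>{a..b}. f x = u + x * v"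
proof -
  let ?A = "{x. f x = u + x * v}"
  have "closed ?A"
    by (intro closed_Collect_eq assms continuous_intros)
  moreover have "{a<..<b} \<subseteq> ?A" using assms(3) by auto
  ultimately have "closure {a<..<b} \<subseteq> ?A" by (rule closure_minimal[rotated])
  then show ?thesis using assms(2) by auto
qed

lemma successively_sorted_list_of_set:
  assumes "finite (Z :: real set)"
  shows "successively (\<lambda>a b. a \<in> Z \<and> b \<in> Z \<and> a < b \<and> Z \<inter> {a<..<b} = {}) (sorted_list_of_set Z)"
proof -
  let ?l = "sorted_list_of_set Z"
  have s: "sorted_wrt (<) ?l" by simp
  show ?thesis
    unfolding successively_conv_nth
  proof (intro allI impI conjI)
    fix i assume i: "Suc i < length ?l"
    show "?l ! i \<in> Z" "?l ! Suc i \<in> Z"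
      using i assms nth_mem[of i ?l] nth_mem[of "Suc i" ?l] by auto
    show "?l ! i < ?l ! Suc i" using s i by (simp add: sorted_wrt_nth_less)
    show "Z \<inter> {?l ! i<..<?l ! Suc i} = {}"
    proof (rule ccontr)
      assume "Z \<inter> {?l ! i<..<?l ! Suc i} \<noteq> {}"
      then obtain z where z: "z \<in> set ?l" "?l ! i < z" "z < ?l ! Suc i" using assms by auto
      then obtain j where j: "j < length ?l" "z = ?l ! j" by (auto simp: in_set_conv_nth)
      have "j \<le> i \<or> Suc i \<le> j" by auto
      then show False
      proof
        assume "j \<le> i"
        then have "?l ! j \<le> ?l ! i" using i by (intro sorted_nth_mono) auto
        then show False using z j by simp
      next
        assume "Suc i \<le> j"
        then have "?l ! Suc i \<le> ?l ! j" using j by (intro sorted_nth_mono) auto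
        then show False using z j by simp
      qed
    qed
  qed
qed

lemma sorted_le_last: "sorted l \<Longrightarrow> x \<in> set l \<Longrightarrow> x \<le> last l"
  by (induction l) auto

text \<open>The breakpoints are refined by a grid of mesh 1/4. Consecutive nodes are then at most
  1/4 apart with no breakpoint between them, so \<open>hat_decomposition\<close> yields hats on
  intervals of length at most 1/2.\<close>

lemma seed_hat_decomposition:
  assumes "compactly_supported p g" "continuous_vec_fun p g" "piecewise_linear p g" "e < p"
  shows "\<exists>hs. (\<forall>(w, a, b, c)\<in>set hs. a < b \<and> b < c \<and> c - a \<le> 1 / 2) \<and>
    (\<forall>x. g x $ e = (\<Sum>(w, a, b, c)\<leftarrow>hs. w * hat a b c x))"
proof -
  obtain B where B1: "finite B" and B2: "\<forall>I. connected I \<and> I \<inter> B = {} \<longrightarrow>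
      (\<exists>u\<in>carrier_vec p. \<exists>v\<in>carrier_vec p. \<forall>x\<in>I. g x = u + x \<cdot>\<^sub>v v)"
    using assms(3) unfolding piecewise_linear_def by (elim exE conjE) (rule that)
  have cont: "continuous_on UNIV (\<lambda>x. g x $ e)"
    using assms(2,4) unfolding continuous_vec_fun_def by blast
  have "bounded ({x. g x \<noteq> 0\<^sub>v p} \<union> B)"
    using assms(1) B1 bounded_subset[OF compact_imp_bounded closure_subset]
    unfolding compactly_supported_def by (simp add: finite_imp_bounded)
  then obtain K where K: "\<And>x. x \<in> {x. g x \<noteq> 0\<^sub>v p} \<union> B \<Longrightarrow> \<bar>x\<bar> \<le> K"
    unfolding bounded_any_center[of _ 0] by (auto simp: dist_real_def)
  \<comment> \<open>\<open>K\<close> bounds support and breakpoints, so \<open>- m / 4\<close> and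
    \<open>m / 4\<close> become the extreme nodes, and \<open>g\<close> vanishes from there
    outwards.\<close>
  obtain m where m: "4 * K < real m" using reals_Archimedean2 by blast
  have supp: "g x $ e = 0" if "real m / 4 \<le> \<bar>x\<bar>" for x
  proof -
    have "g x = 0\<^sub>v p" using K[of x] that m by auto
    then show ?thesis using assms(4) by simp
  qed
  define Z where "Z = (\<lambda>i. real_of_int i / 4) ` {- int m..int m} \<union> B"
  have Z: "finite Z" by (simp add: Z_def B1)
  have Zm: "real m / 4 \<in> Z" "- real m / 4 \<in> Z"
    unfolding Z_def by (intro UnI1 image_eqI[of _ _ "int m"]; simp)
      (intro UnI1 image_eqI[of _ _ "- int m"]; simp)
  have Zb: "\<bar>z\<bar> \<le> real m / 4" if "z \<in> Z" for z
    using that K[of z] m unfolding Z_def by auto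
  define l where "l = sorted_list_of_set Z"
  have "l \<noteq> []" using Zm Z by (auto simp: l_def)
  then obtain z zs where l: "l = z # zs" by (cases l) auto
  have "set l = Z" using Z by (simp add: l_def)
  have sl: "sorted l" by (simp add: l_def)
  have "z = - real m / 4"
  proof -
    have "z \<le> - real m / 4" using sl Zm(2) \<open>set l = Z\<close> l by auto
    moreover have "z \<in> Z" using l \<open>set l = Z\<close> by auto
    ultimately show ?thesis using Zb[of z] by auto
  qed
  moreover have "last (z # zs) = real m / 4"
  proof -
    have "real m / 4 \<le> last l"
      using sl Zm(1) \<open>set l = Z\<close> by (intro sorted_le_last) simp_all
    moreover have "last l \<in> Z" using last_in_set[OF \<open>l \<noteq> []\<close>] \<open>set l = Z\<close> by auto
    ultimately show ?thesis using Zb[of "last l"] l by auto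
  qed
  moreover have "successively (\<lambda>a b. a < b \<and> b - a \<le> 1 / 4 \<and>
      (\<exists>u v. \<forall>x\<in>{a..b}. g x $ e = u + x * v)) (z # zs)"
    using successively_sorted_list_of_set[OF Z] unfolding l_def[symmetric] l
  proof (rule successively_mono)
    fix a b assume "a \<in> Z \<and> b \<in> Z \<and> a < b \<and> Z \<inter> {a<..<b} = {}"
    then have ab: "a \<in> Z" "b \<in> Z" "a < b" "Z \<inter> {a<..<b} = {}" by auto
    have "b - a \<le> 1 / 4"
    proof (rule ccontr)
      assume *: "\<not> b - a \<le> 1 / 4"
      \<comment> \<open>The least integer above \<open>4 * a\<close> gives a grid point that would
        lie strictly between the neighbours \<open>a\<close> and \<open>b\<close>.\<close>
      have "4 * a < of_int (\<lfloor>4 * a\<rfloor> + 1)" "of_int (\<lfloor>4 * a\<rfloor> + 1) \<le> 4 * a + 1" by linarith+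
      then obtain i :: int where i: "4 * a < of_int i" "of_int i \<le> 4 * a + 1" by (rule that)
      have "of_int i < 4 * b" using i * by linarith
      then have "real_of_int (- int m) < of_int i" "of_int i < real_of_int (int m)"
        using i Zb[OF ab(1)] Zb[OF ab(2)] unfolding of_int_minus of_int_of_nat_eq by linarith+
      then have "i \<in> {- int m..int m}" unfolding of_int_less_iff by simp
      then have "real_of_int i / 4 \<in> Z" unfolding Z_def by blast
      moreover have "real_of_int i / 4 \<in> {a<..<b}" 
        using i(1) \<open>of_int i < 4 * b\<close> by simp
      ultimately show False using ab(4) by blast
    qed
    moreover have "\<exists>u v. \<forall>x\<in>{a..b}. g x $ e = u + x * v"
    proof -
      have "{a<..<b} \<inter> B = {}" using ab(4) unfolding Z_def by blast
      then have "\<exists>u\<in>carrier_vec p. \<exists>v\<in>carrier_vec p. \<forall>x\<in>{a<..<b}. g x = u + x \<cdot>\<^sub>v v"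
        using B2[THEN spec, THEN mp, of "{a<..<b}"] by simp
      then obtain u v where uv: "u \<in> carrier_vec p" "v \<in> carrier_vec p"
        "\<forall>x\<in>{a<..<b}. g x = u + x \<cdot>\<^sub>v v"
        by (elim bexE) (rule that)
      then have "g x $ e = u $ e + x * v $ e" if "a < x" "x < b" for x
        using that assms(4) by simp
      then show ?thesis using affine_on_closed_interval[OF cont ab(3)] by blast
    qed
    ultimately show "a < b \<and> b - a \<le> 1 / 4 \<and> (\<exists>u v. \<forall>x\<in>{a..b}. g x $ e = u + x * v)"
      using ab(3) by blast
  qed
  ultimately show ?thesis
    using hat_decomposition[of "1 / 4" "\<lambda>x. g x $ e" z zs] supp by simp
qed

section \<open>Iterated refinement of a scalar seed\<close>

text \<open>Entry \<open>(r, e)\<close> of the iterated refinement of the matrix seed \<open>\<phi>\<close> times the identity.\<close>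

fun cascade :: "int set \<Rightarrow> nat \<Rightarrow> (int \<Rightarrow> real mat) list \<Rightarrow> (real \<Rightarrow> real) \<Rightarrow> nat \<Rightarrow> nat \<Rightarrow> real \<Rightarrow> real"
  where
  "cascade J p [] \<phi> r e x = (if r = e then \<phi> x else 0)"
| "cascade J p (A # As) \<phi> r e x =
    (\<Sum>j\<in>J. \<Sum>s<p. A j $$ (r, s) * cascade J p As \<phi> s e (2 * x - of_int j))"

lemma foldr_refinement_op_carrier:
  assumes "\<And>x. g x \<in> carrier_vec p"
  shows "foldr (refinement_op p J) As g x \<in> carrier_vec p"
  using assms by (cases As) (simp_all add: refinement_op_def)

text \<open>The seed is the sum of its components times unit vectors, and refinement is linear, so
  row \<open>r\<close> collects the entries \<open>(r, e)\<close> of the cascades of the scalar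
  components.\<close>

lemma foldr_refinement_op_eq_cascade:
  assumes "\<And>x. g x \<in> carrier_vec p" "\<forall>A\<in>set As. \<forall>j\<in>J. A j \<in> carrier_mat p p" "r < p"
  shows "foldr (refinement_op p J) As g x $ r = (\<Sum>e<p. cascade J p As (\<lambda>x. g x $ e) r e x)"
  using assms(2,3)
proof (induction As arbitrary: r x)
  case Nil
  then show ?case by simp
next
  case (Cons A As)
  let ?F = "foldr (refinement_op p J) As g"
  have "(A j *\<^sub>v ?F y) $ r = (\<Sum>s<p. A j $$ (r, s) * ?F y $ s)" if "j \<in> J" for j y
  proof -
    have "A j \<in> carrier_mat p p" "?F y \<in> carrier_vec p"
      using Cons.prems that foldr_refinement_op_carrier[OF assms(1)] by auto
    then show ?thesis
      using Cons.prems by (auto simp: scalar_prod_def atLeast0LessThan)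
  qed
  then have "foldr (refinement_op p J) (A # As) g x $ r
      = (\<Sum>j\<in>J. \<Sum>s<p. A j $$ (r, s) * ?F (2 * x - of_int j) $ s)"
    using Cons.prems by (simp add: refinement_op_def)
  also have "\<dots> = (\<Sum>j\<in>J. \<Sum>s<p. \<Sum>e<p. A j $$ (r, s) *
      cascade J p As (\<lambda>x. g x $ e) s e (2 * x - of_int j))"
    using Cons by (simp add: sum_distrib_left)
  also have "\<dots> = (\<Sum>j\<in>J. \<Sum>e<p. \<Sum>s<p. A j $$ (r, s) *
      cascade J p As (\<lambda>x. g x $ e) s e (2 * x - of_int j))"
    by (intro sum.cong refl sum.swap)
  also have "\<dots> = (\<Sum>e<p. cascade J p (A # As) (\<lambda>x. g x $ e) r e x)"
    unfolding cascade.simps by (rule sum.swap)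
  finally show ?case .
qed

lemma cascade_add:
  "cascade J p As (\<lambda>x. f x + g x) r e x = cascade J p As f r e x + cascade J p As g r e x"
  by (induction As arbitrary: r x) (simp_all add: algebra_simps sum.distrib)

lemma cascade_scale: "cascade J p As (\<lambda>x. w * f x) r e x = w * cascade J p As f r e x"
  by (induction As arbitrary: r x) (simp_all add: sum_distrib_left mult.left_commute)

lemma cascade_zero: "cascade J p As (\<lambda>x. 0) r e x = 0"
  by (induction As arbitrary: r x) simp_all

lemma cascade_sum_list:
  "cascade J p As (\<lambda>x. \<Sum>h\<leftarrow>hs. f h x) r e x = (\<Sum>h\<leftarrow>hs. cascade J p As (f h) r e x)"
  by (induction hs) (simp_all add: cascade_add cascade_zero)

text \<open>Each mask doubles the argument, so a shift of the seed is halved once per mask.\<close>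

lemma cascade_translate:
  "cascade J p As (\<lambda>x. f (x - s)) r e x = cascade J p As f r e (x - s / 2 ^ length As)"
  by (induction As arbitrary: r x) (simp_all add: algebra_simps)

text \<open>\<open>\<bar>2 * x - j\<bar>\<close> is at least \<open>2 * \<bar>x\<bar> - L\<close>,
  which exceeds \<open>L\<close> again, so the bound does not grow with the number of masks.\<close>

lemma cascade_support:
  assumes "\<And>x. \<bar>x\<bar> > L \<Longrightarrow> f x = 0" "\<And>j. j \<in> J \<Longrightarrow> \<bar>of_int j\<bar> \<le> L" "\<bar>x\<bar> > L"
  shows "cascade J p As f r e x = 0"
  using assms(3)
proof (induction As arbitrary: r x)
  case Nil
  then show ?case using assms(1) by simp
next
  case (Cons A As)
  have "\<bar>2 * x - of_int j\<bar> > L" if "j \<in> J" for j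
    using assms(2)[OF that] Cons.prems by linarith
  then show ?case using Cons.IH by simp
qed

text \<open>Unfolding all masks leaves only seed values at integer translates of
  \<open>2 ^ length As * x\<close>.\<close>

lemma cascade_eq_0:
  assumes "\<And>i::int. f (2 ^ length As * x - of_int i) = 0"
  shows "cascade J p As f r e x = 0"
  using assms
proof (induction As arbitrary: r x)
  case Nil
  then show ?case using Nil[of 0] by simp
next
  case (Cons A As)
  have "f (2 ^ length As * (2 * x - of_int j) - of_int i) = 0" for i j
    using Cons.prems[of "2 ^ length As * j + i"] by (simp add: algebra_simps)
  then show ?case using Cons.IH by simp
qed

section \<open>Clipping\<close>

text \<open>For \<open>r \<ge> 0\<close> this truncates \<open>v\<close> to \<open>[- r, r]\<close>. With \<open>r = M * b\<close> it multiplies \<open>v\<close>, bounded by \<open>M\<close>,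
  by a bit \<open>b\<close>.\<close>

definition clip :: "real \<Rightarrow> real \<Rightarrow> real" where
  "clip v r = max (v + r) 0 - max (v - r) 0 - r"

lemma clip_eq: "\<bar>v\<bar> \<le> r \<Longrightarrow> clip v r = v"
  by (auto simp: clip_def max_def)

lemma clip_0 [simp]: "clip v 0 = 0"
  by (simp add: clip_def)

text \<open>Multiplies \<open>q\<close> by a ReLU when \<open>q * z\<close> is already at hand: for
  \<open>z \<ge> 0\<close> the product lies within the radius, for negative \<open>z\<close> the
  radius is zero.\<close>

lemma clip_mult_max:
  assumes "\<bar>q\<bar> \<le> M"
  shows "clip (q * z) (M * max z 0) = q * max z 0"
proof (cases "z \<ge> 0")
  case True
  then have "\<bar>q * z\<bar> \<le> M * z" using assms by (simp add: abs_mult mult_right_mono)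
  then show ?thesis using True by (simp add: clip_eq)
qed simp

text \<open>Only an upper bound on the cardinality, as differently named functions may
  coincide.\<close>

definition sized :: "nat \<Rightarrow> 'a set \<Rightarrow> bool" where
  "sized m S \<longleftrightarrow> finite S \<and> card S \<le> m"

lemma sized_Un: "sized m S \<Longrightarrow> sized n T \<Longrightarrow> sized (m + n) (S \<union> T)"
  unfolding sized_def using card_Un_le[of S T] by auto

lemma sized_insert: "sized m S \<Longrightarrow> sized (Suc m) (insert x S)"
  unfolding sized_def by (simp add: card_insert_if)

lemma sized_image: "finite I \<Longrightarrow> sized (card I) (f ` I)"
  unfolding sized_def by (simp add: card_image_le)

lemma sized_empty: "sized 0 {}"
  by (simp add: sized_def)

lemmas sized_intros = sized_Un sized_insert sized_image sized_empty

lemma computes_relu: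
  assumes "computes W D S" "sized m S" "S \<noteq> {}" "sized n G" "G \<subseteq> affine_span S" "2 * m + n \<le> W"
  shows "computes W (Suc D) (S \<union> (\<lambda>f x. max (f x) 0) ` G)"
  using assms computes_layer[of W D S G] unfolding sized_def by simp

text \<open>Each clip costs two neurons; its last summand \<open>- r i\<close> is affine in
  \<open>S\<close> and thus free.\<close>

lemma computes_clip:
  assumes "computes W D S" "sized m S" "S \<noteq> {}" "finite I"
    "\<And>i. i \<in> I \<Longrightarrow> v i \<in> affine_span S" "\<And>i. i \<in> I \<Longrightarrow> r i \<in> affine_span S"
    "2 * m + 2 * card I \<le> W"
  shows "computes W (Suc D) (S \<union> (\<lambda>i x. clip (v i x) (r i x)) ` I)"
proof -
  let ?G = "(\<lambda>i x. v i x + r i x) ` I \<union> (\<lambda>i x. v i x - r i x) ` I"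
  let ?S = "S \<union> (\<lambda>f x. max (f x) 0) ` ?G"
  have "computes W (Suc D) ?S"
  proof (rule computes_relu[OF assms(1-3)])
    show "sized (card I + card I) ?G" using assms(4) by (intro sized_intros)
    show "?G \<subseteq> affine_span S" using assms(5,6) by (auto intro!: affine_span_intros)
    show "2 * m + (card I + card I) \<le> W" using assms(7) by simp
  qed
  then show ?thesis
  proof (rule computes_span)
    have S: "f \<in> affine_span ?S" if "f \<in> affine_span S" for f
      using that by (rule affine_span_trans) (auto intro: affine_span.base)
    have "(\<lambda>x. clip (v i x) (r i x)) \<in> affine_span ?S" if "i \<in> I" for i
    proof -
      have "(\<lambda>x. max (v i x + r i x) 0) \<in> affine_span ?S" "(\<lambda>x. max (v i x - r i x) 0) \<in> affine_span ?S"
        using that by (auto intro!: affine_span.base)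
      then show ?thesis
        unfolding clip_def using S[OF assms(6)[OF that]] by (intro affine_span_intros)
    qed
    then show "S \<union> (\<lambda>i x. clip (v i x) (r i x)) ` I \<subseteq> affine_span ?S"
      by (auto intro: affine_span.base)
  qed
qed

lemma computes_insert_relu:
  assumes "computes W D S" "sized m S" "S \<noteq> {}" "f \<in> affine_span S" "2 * m + 1 \<le> W"
  shows "computes W (Suc D) (insert (\<lambda>x. max (f x) 0) S)"
  using computes_relu[OF assms(1-3), of 1 "{f}"] assms(4,5) by (simp add: sized_def)

lemma computes_insert_clip:
  assumes "computes W D S" "sized m S" "S \<noteq> {}" "v \<in> affine_span S" "r \<in> affine_span S"
    "2 * m + 2 \<le> W"
  shows "computes W (Suc D) (insert (\<lambda>x. clip (v x) (r x)) S)"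
  using computes_clip[OF assms(1-3), of "{()}" "\<lambda>_. v" "\<lambda>_. r"] assms(4-6) by simp

section \<open>Digit-driven transfer of coefficients\<close>

text \<open>Pairs of an integer shift and a component. The shifts are the possible integer parts of
  a point in \<open>[- L - 1, L + 1)\<close>, an interval that contains the support.\<close>

definition offsets :: "int \<Rightarrow> nat \<Rightarrow> (int \<times> nat) set" where
  "offsets L p = {- L - 1..L} \<times> {..<p}"

lemma finite_offsets [simp]: "finite (offsets L p)"
  by (simp add: offsets_def)

text \<open>The row vector \<open>q\<close> times the transition matrix of the mask for digit
  \<open>b\<close>: its block from shift \<open>l\<close> to shift \<open>m\<close> is the mask
  coefficient at \<open>b + 2 * l - m\<close>, read as zero outside \<open>J\<close>.\<close>

definition transfer_step ::
    "int set \<Rightarrow> int \<Rightarrow> nat \<Rightarrow> (int \<Rightarrow> real mat) \<Rightarrow> int \<Rightarrow> (int \<times> nat \<Rightarrow> real) \<Rightarrow> int \<times> nat \<Rightarrow> real" where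
  "transfer_step J L p A b q k = (\<Sum>i\<in>offsets L p. \<Sum>j\<in>J.
      if b + 2 * fst i - j = fst k then q i * A j $$ (snd i, snd k) else 0)"

text \<open>\<open>2 * (t + l) - j = (2 * t - b) + (b + 2 * l - j)\<close>, so all values needed at
  the next level sit at integer shifts of the new point \<open>2 * t - b\<close>.\<close>

lemma transfer_step_cascade:
  assumes supp: "\<And>s y. \<bar>y\<bar> > of_int L \<Longrightarrow> cascade J p As \<phi> s e y = 0"
    and t: "0 \<le> 2 * t - of_int b" "2 * t - of_int b < 1"
  shows "(\<Sum>i\<in>offsets L p. q i * cascade J p (A # As) \<phi> (snd i) e (t + of_int (fst i)))
    = (\<Sum>k\<in>offsets L p. transfer_step J L p A b q k *
        cascade J p As \<phi> (snd k) e (2 * t - of_int b + of_int (fst k)))"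
proof -
  define c where "c m s = cascade J p As \<phi> s e (2 * t - of_int b + of_int m)" for m s
  \<comment> \<open>Shifts that leave the index range contribute nothing, because the new point lies
    in \<open>[0, 1)\<close>.\<close>
  have c0: "c m s = 0" if "m \<notin> {- L - 1..L}" for m s
  proof -
    have "m \<le> - L - 2 \<or> m \<ge> L + 1" using that by auto
    then have "real_of_int m \<le> real_of_int (- L - 2) \<or> real_of_int m \<ge> real_of_int (L + 1)"
      unfolding of_int_le_iff .
    then have "of_int m \<le> - real_of_int L - 2 \<or> of_int m \<ge> real_of_int L + 1" by simp
    then have "\<bar>2 * t - of_int b + of_int m\<bar> > real_of_int L" using t by linarith
    then show ?thesis unfolding c_def by (rule supp)
  qed
  \<comment> \<open>The indicator selects the single shift \<open>m\<close>. If \<open>m\<close> is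
    out of range, nothing matches on the left and the right side vanishes by
    \<open>c0\<close>.\<close>
  have inner: "(\<Sum>k\<in>offsets L p. (if m = fst k then x * f (snd k) else 0) * c (fst k) (snd k))
      = (\<Sum>s<p. x * f s * c m s)" for m x and f :: "nat \<Rightarrow> real"
  proof -
    have "(\<Sum>k\<in>offsets L p. (if m = fst k then x * f (snd k) else 0) * c (fst k) (snd k))
        = (\<Sum>l\<in>{- L - 1..L}. \<Sum>s<p. (if m = l then x * f s else 0) * c l s)"
      unfolding offsets_def sum.cartesian_product by (simp add: case_prod_beta)
    also have "\<dots> = (\<Sum>s<p. \<Sum>l\<in>{- L - 1..L}. (if m = l then x * f s else 0) * c l s)"
      by (rule sum.swap)
    also have "\<dots> = (\<Sum>s<p. \<Sum>l\<in>{- L - 1..L}. if m = l then x * f s * c m s else 0)"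
      by (intro sum.cong refl) simp
    also have "\<dots> = (\<Sum>s<p. x * f s * c m s)"
      by (intro sum.cong refl, subst sum.delta') (use c0 in auto)
    finally show ?thesis .
  qed
  have "(\<Sum>i\<in>offsets L p. q i * cascade J p (A # As) \<phi> (snd i) e (t + of_int (fst i)))
      = (\<Sum>i\<in>offsets L p. \<Sum>j\<in>J. \<Sum>s<p. q i * A j $$ (snd i, s) * c (b + 2 * fst i - j) s)"
    by (simp add: sum_distrib_left c_def algebra_simps)
  also have "\<dots> = (\<Sum>i\<in>offsets L p. \<Sum>j\<in>J. \<Sum>k\<in>offsets L p.
      (if b + 2 * fst i - j = fst k then q i * A j $$ (snd i, snd k) else 0) * c (fst k) (snd k))"
    by (intro sum.cong refl inner[symmetric])
  also have "\<dots> = (\<Sum>i\<in>offsets L p. \<Sum>k\<in>offsets L p. \<Sum>j\<in>J.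
      (if b + 2 * fst i - j = fst k then q i * A j $$ (snd i, snd k) else 0) * c (fst k) (snd k))"
    by (intro sum.cong refl sum.swap)
  also have "\<dots> = (\<Sum>k\<in>offsets L p. \<Sum>i\<in>offsets L p. \<Sum>j\<in>J.
      (if b + 2 * fst i - j = fst k then q i * A j $$ (snd i, snd k) else 0) * c (fst k) (snd k))"
    by (rule sum.swap)
  also have "\<dots> = (\<Sum>k\<in>offsets L p. transfer_step J L p A b q k * c (fst k) (snd k))"
    unfolding transfer_step_def sum_distrib_right ..
  finally show ?thesis unfolding c_def .
qed

text \<open>The sum of all absolute mask entries over the index set works for both digits, as the
  indicator is at most 1. \<open>K\<close> may depend on the mask: it affects the size of weights,
  not of the network.\<close>

lemma transfer_step_bound:
  "\<exists>K\<ge>0. \<forall>q B b. B \<ge> 0 \<longrightarrow> (\<forall>i\<in>offsets L p. \<bar>q i\<bar> \<le> B) \<longrightarrow>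
    (\<forall>k\<in>offsets L p. \<bar>transfer_step J L p A b q k\<bar> \<le> K * B)"
proof -
  define k0 where "k0 s = (\<Sum>i\<in>offsets L p. \<Sum>j\<in>J. \<bar>A j $$ (snd i, s)\<bar>)" for s
  have k0: "k0 s \<ge> 0" for s unfolding k0_def by (intro sum_nonneg) simp
  show ?thesis
  proof (intro exI[of _ "\<Sum>s<p. k0 s"] conjI allI impI ballI)
    show "(\<Sum>s<p. k0 s) \<ge> 0" using k0 by (intro sum_nonneg) simp
  next
    fix q B b k
    assume B: "B \<ge> (0::real)" "\<forall>i\<in>offsets L p. \<bar>q i\<bar> \<le> B" and k: "k \<in> offsets L p"
    have "\<bar>transfer_step J L p A b q k\<bar> \<le> (\<Sum>i\<in>offsets L p. \<Sum>j\<in>J.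
      \<bar>if b + 2 * fst i - j = fst k then q i * A j $$ (snd i, snd k) else 0\<bar>)"
      unfolding transfer_step_def by (intro order_trans[OF sum_abs] sum_mono sum_abs)
    also have "\<dots> \<le> (\<Sum>i\<in>offsets L p. \<Sum>j\<in>J. B * \<bar>A j $$ (snd i, snd k)\<bar>)"
      using B by (intro sum_mono) (auto simp: abs_mult mult_right_mono)
    also have "\<dots> = B * k0 (snd k)" by (simp add: k0_def sum_distrib_left)
    also have "\<dots> \<le> B * (\<Sum>s<p. k0 s)"
      using k k0 B(1) by (intro mult_left_mono member_le_sum) (auto simp: offsets_def)
    finally show "\<bar>transfer_step J L p A b q k\<bar> \<le> (\<Sum>s<p. k0 s) * B" by (simp add: mult.commute)
  qed
qed

lemma transfer_step_scale:
  "transfer_step J L p A b (\<lambda>i. c * q i) k = c * transfer_step J L p A b q k"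
  unfolding transfer_step_def sum_distrib_left by (intro sum.cong refl) simp

lemma transfer_step_cong:
  "(\<And>i. i \<in> offsets L p \<Longrightarrow> q i = q' i) \<Longrightarrow>
    transfer_step J L p A b q k = transfer_step J L p A b q' k"
  unfolding transfer_step_def by (intro sum.cong refl) simp

lemma transfer_step_span:
  assumes "\<And>i. i \<in> offsets L p \<Longrightarrow> q i \<in> affine_span S"
  shows "(\<lambda>x. transfer_step J L p A b (\<lambda>i. q i x) k) \<in> affine_span S"
  unfolding transfer_step_def using assms by (intro affine_span_intros)

section \<open>Doubling, binary digits and the distance to the integers\<close>

lemma frac_double: "frac (2 * y) = 2 * frac y - (if frac y \<ge> 1 / 2 then 1 else 0)" for y :: real
proof -
  have "frac y < 1" "frac y \<ge> 0" by (auto simp: frac_lt_1)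
  moreover have "2 * y - (2 * frac y - (if frac y \<ge> 1 / 2 then 1 else 0))
      = of_int (2 * \<lfloor>y\<rfloor> + (if frac y \<ge> 1 / 2 then 1 else 0))"
    by (simp add: frac_def)
  ultimately show ?thesis
    unfolding frac_unique_iff by (auto simp del: of_int_add of_int_mult)
qed

text \<open>While the fractional part exceeds 1/2, the digit is 1 and the distance up to 1 just
  doubles. Once \<open>2 ^ m * h\<close> exceeds 1/2, the next lower bound is negative and holds
  trivially.\<close>

lemma frac_power_double_gt:
  "frac y > 1 - h \<Longrightarrow> frac (2 ^ m * y) > 1 - 2 ^ m * h" for y h :: real
proof (induction m)
  case (Suc m)
  then have IH: "frac (2 ^ m * y) > 1 - 2 ^ m * h" by simp
  have "frac (2 * (2 ^ m * y)) > 1 - 2 * (2 ^ m * h)"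
  proof (cases "2 ^ m * h \<le> 1 / 2")
    case True
    then show ?thesis using IH by (simp add: frac_double)
  next
    case False
    then show ?thesis using frac_ge_0[of "2 * (2 ^ m * y)"] by linarith
  qed
  then show ?case by (simp add: mult.assoc)
qed simp

text \<open>Contrapositive: a fractional part closer to 1 than \<open>1 / (8 * 2 ^ n)\<close> would
  be within 1/8 of 1 after the remaining doublings. One margin thus protects all digits.\<close>

lemma frac_power_le:
  fixes y :: real
  assumes "frac (2 ^ n * y) \<le> 7 / 8" "k \<le> n"
  shows "frac (2 ^ k * y) \<le> 1 - 1 / (8 * 2 ^ n)"
proof (rule ccontr)
  assume "\<not> ?thesis"
  then have gt: "frac (2 ^ (n - k) * (2 ^ k * y)) > 1 - 2 ^ (n - k) * (1 / (8 * 2 ^ n))"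
    by (intro frac_power_double_gt) simp
  have eq: "2 ^ (n - k) * (2 ^ k * y) = 2 ^ n * y"
    using assms(2) by (simp flip: mult.assoc power_add)
  have "(2::real) ^ (n - k) * (1 / (8 * 2 ^ n)) \<le> 1 / 8"
    using power_increasing[of "n - k" n "2::real"] by (simp add: field_simps)
  then show False using assms(1) gt unfolding eq by linarith
qed

text \<open>The ramp rises from 0 to 1 for \<open>t\<close> between
  \<open>(1 - \<epsilon>) / 2\<close> and \<open>1 / 2\<close>. The hypothesis keeps
  \<open>t\<close> out of its interior, where the digit is 0 and \<open>2 * t\<close> exceeds
  \<open>1 - \<epsilon>\<close>.\<close>

lemma ramp_digit:
  fixes \<epsilon> t :: real
  assumes "\<epsilon> > 0" "2 * t - (if t \<ge> 1 / 2 then 1 else 0) \<le> 1 - \<epsilon>"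
  shows "(max (2 * t - 1 + \<epsilon>) 0 - max (2 * t - 1) 0) / \<epsilon> = (if t \<ge> 1 / 2 then 1 else 0)"
proof (cases "t \<ge> 1 / 2")
  case True
  then show ?thesis using assms by simp
next
  case False
  then have "2 * t - 1 + \<epsilon> \<le> 0" "2 * t - 1 \<le> 0" using assms by auto
  then show ?thesis using False by (simp add: max_def)
qed

text \<open>Doubling acts on the distance to the integers by a fixed piecewise-linear map without
  digits, so the distance can be computed exactly even where the digits are wrong.\<close>

lemma tent_double:
  fixes t :: real
  assumes "0 \<le> t" "t < 1"
  shows "2 * min t (1 - t) - max (4 * min t (1 - t) - 1) 0
    = min (2 * t - (if t \<ge> 1 / 2 then 1 else 0)) (1 - (2 * t - (if t \<ge> 1 / 2 then 1 else 0)))"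
proof (cases "t \<ge> 1 / 2")
  case True
  then show ?thesis using assms by (simp add: max_def min_def)
next
  case False
  then show ?thesis using assms by (simp add: max_def min_def)
qed

section \<open>The network for one hat\<close>

text \<open>\<open>G\<close> is the set of inputs on which all digits are computed exactly; \<open>t\<close>, \<open>q\<close> and \<open>S\<close> are
  arbitrary outside \<open>G\<close>.\<close>

lemma cascade_network_output:
  assumes hat: "a < b" "b < c" "1 / 4 \<le> a" "c \<le> 3 / 4"
    and D: "\<And>x. x \<in> G \<Longrightarrow> D x = min (t x) (1 - t x)" "\<And>x. x \<notin> G \<Longrightarrow> D x \<le> 1 / 8"
    and q: "\<And>x. x \<in> G \<Longrightarrow> \<bar>q x\<bar> \<le> B" "\<And>x. x \<in> G \<Longrightarrow> S x = t x * q x"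
    and F: "\<And>x. x \<in> G \<Longrightarrow> F x = q x * hat a b c (t x)" "\<And>x. x \<notin> G \<Longrightarrow> F x = 0"
    and P: "computes W d (P \<union> {t, D, q, S})" "sized m P" "2 * m + 20 \<le> W"
  shows "computes W (d + 6) (insert F P)"
proof -
  \<comment> \<open>\<open>k\<close> is the drop of slope at the peak; \<open>\<rho>\<close> and
    \<open>H\<close> are the inner and outer maximum of the hat at \<open>t x\<close>.\<close>
  define k where "k = 1 / (b - a) + 1 / (c - b)"
  define \<rho> where "\<rho> x = max (t x - b) 0" for x
  define s where "s x = max (D x - 1 / 8) 0" for x
  define H where "H x = max ((t x - a) / (b - a) - k * \<rho> x) 0" for x
  \<comment> \<open>On \<open>G\<close> the first argument is \<open>q x * (t x - b)\<close>, so
    this clip is \<open>q x * \<rho> x\<close>.\<close>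
  define w where "w x = clip (S x - b * q x) (B * \<rho> x)" for x
  \<comment> \<open>On \<open>G\<close>, \<open>s\<close> is at least 1/8 wherever \<open>H\<close>
    is positive, and \<open>H\<close> is at most 1; the factor 8 therefore makes \<open>u\<close>
    zero on \<open>G\<close>. Off \<open>G\<close>, \<open>s\<close> is 0 and \<open>u\<close>
    equals \<open>H\<close>.\<close>
  define u where "u x = max (H x - 8 * s x) 0" for x
  let ?T0 = "insert t (insert D (insert q (insert S P)))"
  let ?T1 = "insert \<rho> ?T0"
  let ?T2 = "insert s ?T1"
  let ?T3 = "insert H ?T2"
  let ?T4 = "insert w ?T3"
  let ?T5 = "insert u ?T4"
  have W: "2 * Suc (Suc (Suc (Suc (Suc (Suc (Suc (Suc (Suc m)))))))) + 2 \<le> W"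
    using P(3) by simp
  note z0 = sized_insert[OF sized_insert[OF sized_insert[OF sized_insert[OF P(2)]]]]
  note z1 = sized_insert[OF z0]
  note z2 = sized_insert[OF z1]
  note z3 = sized_insert[OF z2]
  note z4 = sized_insert[OF z3]
  note z5 = sized_insert[OF z4]
  have "computes W d ?T0"
    using P(1) by (simp add: insert_commute)
  then have "computes W (Suc d) ?T1"
    unfolding \<rho>_def[abs_def]
    by (rule computes_insert_relu[OF _ z0])
      ((intro affine_span_intros | (rule affine_span.base, blast) | (use W in simp))+)
  then have "computes W (Suc (Suc d)) ?T2"
    unfolding s_def[abs_def]
    by (rule computes_insert_relu[OF _ z1])
      ((intro affine_span_intros | (rule affine_span.base, blast) | (use W in simp))+)
  then have "computes W (Suc (Suc (Suc d))) ?T3"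
    unfolding H_def[abs_def]
    by (rule computes_insert_relu[OF _ z2])
      ((intro affine_span_intros | (rule affine_span.base, blast) | (use W in simp))+)
  then have "computes W (Suc (Suc (Suc (Suc d)))) ?T4"
    unfolding w_def[abs_def]
    by (rule computes_insert_clip[OF _ z3])
      ((intro affine_span_intros | (rule affine_span.base, blast) | (use W in simp))+)
  then have "computes W (Suc (Suc (Suc (Suc (Suc d))))) ?T5"
    unfolding u_def[abs_def]
    by (rule computes_insert_relu[OF _ z4])
      ((intro affine_span_intros | (rule affine_span.base, blast) | (use W in simp))+)
  then have "computes W (Suc (Suc (Suc (Suc (Suc (Suc d))))))
      (insert (\<lambda>x. clip ((S x - a * q x) / (b - a) - k * w x) (B * (H x - u x))) ?T5)"
    by (rule computes_insert_clip[OF _ z5])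
      ((intro affine_span_intros | (rule affine_span.base, blast) | (use W in simp))+)
  \<comment> \<open>The radius is \<open>B * H x\<close> on \<open>G\<close>, where the clip gives
    \<open>q x * H x\<close>, and 0 elsewhere, which erases wrong values.\<close>
  moreover have "clip ((S x - a * q x) / (b - a) - k * w x) (B * (H x - u x)) = F x" for x
  proof (cases "x \<in> G")
    case True
    have H: "H x = hat a b c (t x)" by (simp add: H_def hat_def k_def \<rho>_def)
    have "S x - b * q x = q x * (t x - b)" using q(2)[OF True] by (simp add: algebra_simps)
    then have "w x = q x * \<rho> x"
      unfolding w_def \<rho>_def using clip_mult_max[OF q(1)[OF True]] by simp
    then have "(S x - a * q x) / (b - a) - k * w x = q x * ((t x - a) / (b - a) - k * \<rho> x)"
      using q(2)[OF True] by (simp add: algebra_simps flip: diff_divide_distrib)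
    moreover have "u x = 0"
    proof (cases "t x \<le> a \<or> c \<le> t x")
      case True
      then have "H x = 0" unfolding H using hat hat_eq_0 by blast
      then show ?thesis by (simp add: u_def s_def)
    next
      case False
      then have "s x \<ge> 1 / 8" using D(1)[OF True] hat by (auto simp: s_def min_def)
      moreover have "H x \<le> 1" unfolding H using hat hat_le_1 by blast
      ultimately show ?thesis by (simp add: u_def)
    qed
    ultimately show ?thesis
      using F(1)[OF True] clip_mult_max[OF q(1)[OF True], of "(t x - a) / (b - a) - k * \<rho> x"]
      unfolding H[symmetric] by (simp add: H_def)
  next
    case False
    then have "s x = 0" using D(2)[OF False] by (simp add: s_def)
    moreover have "H x \<ge> 0" by (simp add: H_def)
    ultimately show ?thesis using F(2)[OF False] by (simp add: u_def)
  qed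
  ultimately have "computes W (d + 6) (insert F ?T5)"
    by (simp add: numeral_eq_Suc)
  then show ?thesis by (rule computes_span) (auto intro: affine_span.base)
qed

text \<open>With digit \<open>b\<close> and transfer steps \<open>T 0\<close>, \<open>T 1\<close>,
  the updates are \<open>t' = 2 * t - b\<close>, \<open>q' = T 0 q + b * (T 1 q - T 0 q)\<close>
  and, as \<open>S = t * q\<close>,
  \<open>S' = 2 * T 0 S + b * (2 * (T 1 S - T 0 S) - T 1 q)\<close>. Products with the digit are
  clips. The three layers produce the digit with the tent, then \<open>q'\<close>, then
  \<open>S'\<close>.\<close>

lemma cascade_network_step:
  assumes L: "\<And>s y. \<bar>y\<bar> > of_int L \<Longrightarrow> cascade J p As \<phi> s e y = 0"
    and \<epsilon>: "\<epsilon> > 0" and GR: "G \<subseteq> R"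
    and D: "\<And>x. x \<in> R \<Longrightarrow> D x = min (frac (y x)) (1 - frac (y x))" "\<And>x. x \<notin> R \<Longrightarrow> D x = 0"
    and inv: "\<And>x. x \<in> G \<Longrightarrow> t x = frac (y x)" "\<And>x. x \<in> G \<Longrightarrow> frac (2 * y x) \<le> 1 - \<epsilon>"
      "\<And>x i. x \<in> G \<Longrightarrow> i \<in> offsets L p \<Longrightarrow> S i x = t x * q i x"
      "\<And>x i. x \<in> G \<Longrightarrow> i \<in> offsets L p \<Longrightarrow> \<bar>q i x\<bar> \<le> B" "B \<ge> 0"
      "\<And>x. x \<in> G \<Longrightarrow> F x =
        (\<Sum>i\<in>offsets L p. q i x * cascade J p (A # As) \<phi> (snd i) e (t x + of_int (fst i)))"
    and P: "computes W d (P \<union> {t, D} \<union> q ` offsets L p \<union> S ` offsets L p)" "sized m P"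
      "2 * m + 10 * card (offsets L p) + 20 \<le> W"
  obtains t' D' q' S' B' where
    "\<And>x. x \<in> R \<Longrightarrow> D' x = min (frac (2 * y x)) (1 - frac (2 * y x))" "\<And>x. x \<notin> R \<Longrightarrow> D' x = 0"
    "\<And>x. x \<in> G \<Longrightarrow> t' x = frac (2 * y x)"
    "\<And>x i. x \<in> G \<Longrightarrow> i \<in> offsets L p \<Longrightarrow> S' i x = t' x * q' i x"
    "\<And>x i. x \<in> G \<Longrightarrow> i \<in> offsets L p \<Longrightarrow> \<bar>q' i x\<bar> \<le> B'" "B' \<ge> 0"
    "\<And>x. x \<in> G \<Longrightarrow> F x =
      (\<Sum>i\<in>offsets L p. q' i x * cascade J p As \<phi> (snd i) e (t' x + of_int (fst i)))"
    "computes W (d + 3) (P \<union> {t', D'} \<union> q' ` offsets L p \<union> S' ` offsets L p)"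
proof -
  let ?I = "offsets L p"
  obtain K where K: "K \<ge> 0" "\<forall>q B b. B \<ge> 0 \<longrightarrow> (\<forall>i\<in>?I. \<bar>q i\<bar> \<le> B) \<longrightarrow>
      (\<forall>k\<in>?I. \<bar>transfer_step J L p A b q k\<bar> \<le> K * B)"
    using transfer_step_bound[of L p J A] by (elim exE conjE) (rule that)
  \<comment> \<open>On \<open>G\<close>, \<open>T b q\<close> and \<open>T b S\<close> are bounded
    by \<open>K * B\<close>, as \<open>t\<close> is in \<open>[0, 1)\<close>; the coefficients 2, 2
    and 1 in \<open>cS\<close> add up to 5.\<close>
  define M where "M = 5 * (K * B)"
  have KB: "K * B \<ge> 0" using K(1) inv(5) by simp
  define T where "T b q i x = transfer_step J L p A b (\<lambda>i. q i x) i"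
    for b and q :: "int \<times> nat \<Rightarrow> real \<Rightarrow> real" and i x
  define \<beta> where "\<beta> x = (max (2 * t x - 1 + \<epsilon>) 0 - max (2 * t x - 1) 0) / \<epsilon>" for x
  define t' where "t' x = 2 * t x - \<beta> x" for x
  define D' where "D' x = 2 * D x - max (4 * D x - 1) 0" for x
  define cq where "cq i x = clip (T 1 q i x - T 0 q i x) (M * \<beta> x)" for i x
  define cS where "cS i x = clip (2 * (T 1 S i x - T 0 S i x) - T 1 q i x) (M * \<beta> x)" for i x
  define q' where "q' i x = T 0 q i x + cq i x" for i x
  define S' where "S' i x = 2 * T 0 S i x + cS i x" for i x
  let ?T0 = "P \<union> {t, D} \<union> q ` ?I \<union> S ` ?I"
  let ?G = "{\<lambda>x. 2 * t x - 1 + \<epsilon>, \<lambda>x. 2 * t x - 1, \<lambda>x. 4 * D x - 1}"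
  let ?T1 = "P \<union> {t', D', \<beta>} \<union> q ` ?I \<union> S ` ?I"
  have T_span: "T b f i \<in> affine_span V" if "f ` ?I \<subseteq> V" for b f i V
    using transfer_step_span[of L p f V J A b i] that affine_span.base
    unfolding T_def[abs_def] by blast
  have "computes W (Suc d) (?T0 \<union> (\<lambda>f x. max (f x) 0) ` ?G)"
  proof (rule computes_relu[OF P(1)])
    show "sized (m + 2 + card ?I + card ?I) ?T0"
      using sized_insert[OF sized_insert[OF sized_empty]]
      by (intro sized_Un sized_image P(2)) (simp_all add: numeral_eq_Suc)
    show "sized 3 ?G" by (auto simp: sized_def card_insert_if)
    have "t \<in> affine_span ?T0" "D \<in> affine_span ?T0" by (auto intro: affine_span.base)
    then show "?G \<subseteq> affine_span ?T0" by (auto intro!: affine_span_intros)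
    show "2 * (m + 2 + card ?I + card ?I) + 3 \<le> W" using P(3) by simp
  qed simp
  then have "computes W (Suc d) ?T1"
  proof (rule computes_span)
    let ?V = "?T0 \<union> (\<lambda>f x. max (f x) 0) ` ?G"
    have a: "t \<in> affine_span ?V" "D \<in> affine_span ?V"
      "(\<lambda>x. max (2 * t x - 1 + \<epsilon>) 0) \<in> affine_span ?V"
      "(\<lambda>x. max (2 * t x - 1) 0) \<in> affine_span ?V"
      "(\<lambda>x. max (4 * D x - 1) 0) \<in> affine_span ?V"
      by (auto intro: affine_span.base)
    then have b: "\<beta> \<in> affine_span ?V" unfolding \<beta>_def[abs_def] by (intro affine_span_intros)
    have "t' \<in> affine_span ?V" unfolding t'_def[abs_def] using a b by (intro affine_span_intros)
    moreover have "D' \<in> affine_span ?V" unfolding D'_def[abs_def] using a by (intro affine_span_intros)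
    ultimately show "?T1 \<subseteq> affine_span ?V"
      using b by (auto intro: affine_span.base)
  qed
  then have "computes W (Suc (Suc d)) (?T1 \<union> cq ` ?I)"
    unfolding cq_def[abs_def]
  proof (rule computes_clip)
    show "sized (m + 3 + card ?I + card ?I) ?T1"
      using sized_insert[OF sized_insert[OF sized_insert[OF sized_empty]]]
      by (intro sized_Un sized_image P(2)) (simp_all add: numeral_eq_Suc)
    show "(\<lambda>x. M * \<beta> x) \<in> affine_span ?T1" for i :: "int \<times> nat"
      by (intro affine_span.scale affine_span.base) simp
    show "(\<lambda>x. T 1 q i x - T 0 q i x) \<in> affine_span ?T1" for i
      by (intro affine_span_diff T_span) auto
    show "2 * (m + 3 + card ?I + card ?I) + 2 * card ?I \<le> W" using P(3) by simp
  qed simp_all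
  then have "computes W (Suc (Suc (Suc d))) (?T1 \<union> cq ` ?I \<union> cS ` ?I)"
    unfolding cS_def[abs_def]
  proof (rule computes_clip)
    show "sized (m + 3 + card ?I + card ?I + card ?I) (?T1 \<union> cq ` ?I)"
      using sized_insert[OF sized_insert[OF sized_insert[OF sized_empty]]]
      by (intro sized_Un sized_image P(2)) (simp_all add: numeral_eq_Suc)
    show "(\<lambda>x. M * \<beta> x) \<in> affine_span (?T1 \<union> cq ` ?I)" for i :: "int \<times> nat"
      by (intro affine_span.scale affine_span.base) simp
    show "(\<lambda>x. 2 * (T 1 S i x - T 0 S i x) - T 1 q i x) \<in> affine_span (?T1 \<union> cq ` ?I)" for i
      by (intro affine_span_diff affine_span.scale T_span) auto
    show "2 * (m + 3 + card ?I + card ?I + card ?I) + 2 * card ?I \<le> W" using P(3) by simp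
  qed simp_all
  then have comp: "computes W (d + 3) (P \<union> {t', D'} \<union> q' ` ?I \<union> S' ` ?I)"
    unfolding numeral_3_eq_3 add_Suc_right add_0_right
  proof (rule computes_span)
    let ?V = "?T1 \<union> cq ` ?I \<union> cS ` ?I"
    have "q' i \<in> affine_span ?V" "S' i \<in> affine_span ?V" if "i \<in> ?I" for i
    proof -
      have "cq i \<in> affine_span ?V" "cS i \<in> affine_span ?V"
        using that by (auto intro: affine_span.base)
      moreover have "T 0 q i \<in> affine_span ?V" "T 0 S i \<in> affine_span ?V"
        by (intro T_span; auto)+
      ultimately show "q' i \<in> affine_span ?V" "S' i \<in> affine_span ?V"
        unfolding q'_def[abs_def] S'_def[abs_def]
        by - (intro affine_span_intros; assumption)+
    qed
    then show "P \<union> {t', D'} \<union> q' ` ?I \<union> S' ` ?I \<subseteq> affine_span ?V"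
      by (auto intro: affine_span.base)
  qed
  have good: "t' x = frac (2 * y x) \<and> (\<forall>i\<in>?I. S' i x = t' x * q' i x \<and> \<bar>q' i x\<bar> \<le> K * B) \<and>
      F x = (\<Sum>i\<in>?I. q' i x * cascade J p As \<phi> (snd i) e (t' x + of_int (fst i)))"
    if x: "x \<in> G" for x
  proof -
    define b :: int where "b = (if t x \<ge> 1 / 2 then 1 else 0)"
    have t01: "0 \<le> t x" "t x < 1" using inv(1)[OF x] by (simp_all add: frac_lt_1)
    have fr: "frac (2 * y x) = 2 * t x - of_int b"
      using inv(1)[OF x] by (simp add: frac_double b_def)
    have of_b: "real_of_int b = (if t x \<ge> 1 / 2 then 1 else 0)" by (simp add: b_def)
    have \<beta>: "\<beta> x = of_int b"
      unfolding \<beta>_def of_b using inv(2)[OF x] unfolding fr of_b by (rule ramp_digit[OF \<epsilon>])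
    have t': "t' x = frac (2 * y x)" by (simp add: t'_def \<beta> fr)
    \<comment> \<open>Transfer is linear, hence commutes with multiplication by the number
      \<open>t x\<close>.\<close>
    have TS: "T c S i x = t x * T c q i x" for c i
      unfolding T_def transfer_step_scale[symmetric] using inv(3)[OF x] by (intro transfer_step_cong)
    have Tq: "\<bar>T c q i x\<bar> \<le> K * B" if "i \<in> ?I" for c i
      unfolding T_def using K(2) inv(4)[OF x] inv(5) that by simp
    have tT: "\<bar>t x * T c q i x\<bar> \<le> K * B" if "i \<in> ?I" for c i
      using mult_mono[of "\<bar>t x\<bar>" 1 "\<bar>T c q i x\<bar>" "K * B"] Tq[OF that] t01 by (simp add: abs_mult)
    have q': "q' i x = T b q i x" if "i \<in> ?I" for i
    proof (cases "b = 1")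
      case True
      have "\<bar>T 1 q i x - T 0 q i x\<bar> \<le> M"
        using Tq[OF that, of 1] Tq[OF that, of 0] KB unfolding M_def by linarith
      then show ?thesis using True by (simp add: q'_def cq_def \<beta> clip_eq)
    next
      case False
      then have "b = 0" by (auto simp: b_def split: if_splits)
      then show ?thesis by (simp add: q'_def cq_def \<beta>)
    qed
    have five: "\<bar>u\<bar> \<le> h \<Longrightarrow> \<bar>v\<bar> \<le> h \<Longrightarrow> \<bar>w\<bar> \<le> h \<Longrightarrow> \<bar>2 * (u - v) - w\<bar> \<le> 5 * h"
      for u v w h :: real by (auto simp: abs_le_iff)
    have S': "S' i x = t' x * q' i x" if "i \<in> ?I" for i
    proof (cases "b = 1")
      case True
      have "\<bar>2 * (t x * T 1 q i x - t x * T 0 q i x) - T 1 q i x\<bar> \<le> M"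
        using tT[OF that, of 1] tT[OF that, of 0] Tq[OF that, of 1] unfolding M_def by (rule five)
      then have "S' i x = 2 * (t x * T 1 q i x) - T 1 q i x"
        using True by (simp add: S'_def cS_def \<beta> clip_eq TS)
      then show ?thesis using True q'[OF that] by (simp add: t'_def \<beta> left_diff_distrib)
    next
      case False
      then have "b = 0" by (auto simp: b_def split: if_splits)
      then show ?thesis using q'[OF that] by (simp add: S'_def cS_def \<beta> TS t'_def)
    qed
    have "0 \<le> 2 * t x - of_int b" "2 * t x - of_int b < 1"
      using frac_ge_0[of "2 * y x"] frac_lt_1[of "2 * y x"] unfolding fr by auto
    then have "F x = (\<Sum>k\<in>?I. T b q k x * cascade J p As \<phi> (snd k) e (2 * t x - of_int b + of_int (fst k)))"
      unfolding inv(6)[OF x] T_def by (intro transfer_step_cascade L)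
    also have "\<dots> = (\<Sum>i\<in>?I. q' i x * cascade J p As \<phi> (snd i) e (t' x + of_int (fst i)))"
      by (intro sum.cong refl) (simp add: q' t' fr)
    finally show ?thesis using t' S' q' Tq by simp
  qed
  show ?thesis
  proof (rule that[of D' t' S' q' "K * B"])
    show "D' x = min (frac (2 * y x)) (1 - frac (2 * y x))" if "x \<in> R" for x
      using tent_double[of "frac (y x)"] frac_lt_1[of "y x"] D(1)[OF that]
      by (simp add: D'_def frac_double)
    show "D' x = 0" if "x \<notin> R" for x using D(2)[OF that] by (simp add: D'_def)
  qed (use good KB comp in blast)+
qed

text \<open>Induction on the masks still to be applied; \<open>k\<close> counts the digits already
  consumed. By \<open>frac_power_le\<close> the margin \<open>1 / (8 * 2 ^ n)\<close> serves every
  step.\<close>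

lemma cascade_network_run:
  assumes hat: "a < b" "b < c" "1 / 4 \<le> a" "c \<le> 3 / 4"
    and L: "L \<ge> 1" "\<And>j. j \<in> J \<Longrightarrow> \<bar>j\<bar> \<le> L" and e: "e < p" and GR: "G \<subseteq> R"
    and n: "n = k + length As"
    and G: "\<And>x. x \<in> G \<Longrightarrow> frac (2 ^ n * X x) \<le> 7 / 8"
      "\<And>x. x \<in> R \<Longrightarrow> x \<notin> G \<Longrightarrow> frac (2 ^ n * X x) > 7 / 8" "\<And>x. x \<notin> G \<Longrightarrow> F x = 0"
    and D: "\<And>x. x \<in> R \<Longrightarrow> D x = min (frac (2 ^ k * X x)) (1 - frac (2 ^ k * X x))"
      "\<And>x. x \<notin> R \<Longrightarrow> D x = 0"
    and inv: "\<And>x. x \<in> G \<Longrightarrow> t x = frac (2 ^ k * X x)"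
      "\<And>x i. x \<in> G \<Longrightarrow> i \<in> offsets L p \<Longrightarrow> S i x = t x * q i x"
      "\<And>x i. x \<in> G \<Longrightarrow> i \<in> offsets L p \<Longrightarrow> \<bar>q i x\<bar> \<le> B" "B \<ge> 0"
      "\<And>x. x \<in> G \<Longrightarrow> F x =
        (\<Sum>i\<in>offsets L p. q i x * cascade J p As (hat a b c) (snd i) e (t x + of_int (fst i)))"
    and P: "computes W d (P \<union> {t, D} \<union> q ` offsets L p \<union> S ` offsets L p)" "sized m P"
      "2 * m + 10 * card (offsets L p) + 20 \<le> W"
  shows "computes W (d + 3 * length As + 6) (insert F P)"
  using n D inv P(1)
proof (induction As arbitrary: k D t S q B d)
  case Nil
  note D = Nil.prems(2,3) and inv = Nil.prems(4-8) and n = Nil.prems(1)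
  \<comment> \<open>With no mask left, only this index counts: the hat lives in
    \<open>[1/4, 3/4]\<close>, so a nonzero integer shift of a point of \<open>[0, 1)\<close> misses
    it, and components other than \<open>e\<close> are zero.\<close>
  have i: "(0, e) \<in> offsets L p" using e L(1) by (auto simp: offsets_def)
  show ?case unfolding list.size mult_0_right add_0_right
  proof (rule cascade_network_output[OF hat])
    show "D x = min (t x) (1 - t x)" if "x \<in> G" for x
      using D(1)[of x] inv(1)[OF that] GR that by auto
    show "D x \<le> 1 / 8" if "x \<notin> G" for x
    proof (cases "x \<in> R")
      case True
      \<comment> \<open>Off \<open>G\<close> the fractional part exceeds 7/8, so its distance to 1
        is below 1/8.\<close>
      then show ?thesis using D(1)[OF True] G(2)[OF True that] n by auto
    qed (simp add: D(2))
    show "\<bar>q (0, e) x\<bar> \<le> B" "S (0, e) x = t x * q (0, e) x" if "x \<in> G" for x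
      using inv(2,3)[OF that i] by auto
    show "F x = q (0, e) x * hat a b c (t x)" if "x \<in> G" for x
    proof -
      have t01: "0 \<le> t x" "t x < 1" using inv(1)[OF that] by (simp_all add: frac_lt_1)
      have 0: "hat a b c (t x + of_int l) = 0" if "l \<noteq> 0" for l :: int
      proof -
        have "l \<le> -1 \<or> l \<ge> 1" using that by auto
        then have "t x + of_int l \<le> a \<or> c \<le> t x + of_int l" using t01 hat by auto
        then show ?thesis using hat hat_eq_0 by blast
      qed
      have "F x = (\<Sum>i\<in>offsets L p. if i = (0, e) then q (0, e) x * hat a b c (t x) else 0)"
        unfolding inv(5)[OF that]
        by (intro sum.cong refl) (auto simp: 0 prod_eq_iff)
      then show ?thesis using i by simp
    qed
    show "computes W d (P \<union> {t, D, q (0, e), S (0, e)})"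
      using Nil.prems(9) by (rule computes_span) (use i in \<open>auto intro: affine_span.base\<close>)
    show "2 * m + 20 \<le> W" using P(3) by simp
  qed (use G(3) P(2) in auto)
next
  case (Cons A As)
  have n: "n = k + length (A # As)" by fact
  have L': "\<bar>real_of_int j\<bar> \<le> of_int L" if "j \<in> J" for j
    using L(2)[OF that] by (simp flip: of_int_abs)
  have supp: "cascade J p As (hat a b c) s e y = 0" if "\<bar>y\<bar> > of_int L" for s y
  proof (rule cascade_support[OF _ L' that])
    fix x assume "\<bar>x\<bar> > real_of_int L"
    moreover have "real_of_int L \<ge> 1" using L(1) by simp
    ultimately have "x \<le> a \<or> c \<le> x" using hat by linarith
    then show "hat a b c x = 0" using hat hat_eq_0 by blast
  qed
  have e0: "1 / (8 * 2 ^ n) > (0::real)" by simp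
  have fr: "frac (2 * (2 ^ k * X x)) \<le> 1 - 1 / (8 * 2 ^ n)" if "x \<in> G" for x
    using frac_power_le[OF G(1)[OF that], of "Suc k"] n by (simp add: mult.assoc)
  have pow: "2 * (2 ^ k * X x) = 2 ^ Suc k * X x" for x by simp
  have n': "n = Suc k + length As" using n by simp
  show ?case
  proof ((rule cascade_network_step[OF supp e0 GR Cons.prems(2-4) fr Cons.prems(5-9) P(2,3)];
        assumption?), goal_cases)
    case (1 D' t' S' q' B')
    from Cons.IH[OF n' 1(1-3)[unfolded pow] 1(4-8)]
    have "computes W (d + 3 + 3 * length As + 6) (insert F P)" .
    then show ?case by (simp add: algebra_simps)
  qed
qed

text \<open>Every breakpoint is written as a summand, \<open>y + k\<close>, to match syntactically the neurons of the first
  layer.\<close>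

definition pulse :: "real \<Rightarrow> real \<Rightarrow> real" where
  "pulse \<epsilon> y = (max (y + \<epsilon>) 0 - max y 0) / \<epsilon> - (max (y + (\<epsilon> - 1)) 0 - max (y + -1) 0) / \<epsilon>"

definition sawtooth :: "real \<Rightarrow> real \<Rightarrow> real" where
  "sawtooth \<epsilon> y = max y 0 - max (y + (\<epsilon> - 1)) 0 / \<epsilon> + (1 / \<epsilon> - 1) * max (y + -1) 0"

definition tent :: "real \<Rightarrow> real" where
  "tent y = max y 0 - 2 * max (y + - 1 / 2) 0 + max (y + -1) 0"

text \<open>\<open>pulse\<close> imitates the indicator of \<open>[0, 1)\<close> and
  \<open>sawtooth\<close> the identity cut off to it, each jump being replaced by a ramp of length
  \<open>\<epsilon>\<close> to its left. This lemma and the next give the values off the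
  ramps.\<close>

lemma pulse_eq:
  assumes "0 < \<epsilon>" "\<epsilon> \<le> 1"
  shows "0 \<le> y \<Longrightarrow> y \<le> 1 - \<epsilon> \<Longrightarrow> pulse \<epsilon> y = 1"
    and "y \<le> - \<epsilon> \<or> 1 \<le> y \<Longrightarrow> pulse \<epsilon> y = 0"
  using assms by (auto simp: pulse_def)

lemma sawtooth_eq:
  assumes "0 < \<epsilon>" "\<epsilon> \<le> 1"
  shows "0 \<le> y \<Longrightarrow> y \<le> 1 - \<epsilon> \<Longrightarrow> sawtooth \<epsilon> y = y"
    and "y \<le> 0 \<or> 1 \<le> y \<Longrightarrow> sawtooth \<epsilon> y = 0"
  using assms by (auto simp: sawtooth_def field_simps)

lemma tent_eq:
  "0 \<le> y \<Longrightarrow> y \<le> 1 \<Longrightarrow> tent y = min y (1 - y)"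
  "y \<le> 0 \<or> 1 \<le> y \<Longrightarrow> tent y = 0"
  by (auto simp: tent_def max_def min_def)

text \<open>The integer part of \<open>y\<close> is among the shifts, and every other translate
  falls where \<open>f\<close> is assumed to vanish. Summing translates thus reaches
  \<open>frac y\<close> without computing the integer part.\<close>

lemma sum_int_offsets_eq_floor:
  fixes y :: real
  assumes "- of_int L - 1 \<le> y" "y < of_int L + 1"
    and "\<And>l::int. y - of_int l \<le> frac y - 1 \<or> 1 \<le> y - of_int l \<Longrightarrow> f (y - of_int l) = 0"
  shows "(\<Sum>l\<in>{- L - 1..L}. f (y - of_int l)) = f (frac y)"
proof -
  have m: "\<lfloor>y\<rfloor> \<in> {- L - 1..L}"
    using assms(1,2) by (auto simp: le_floor_iff floor_le_iff)
  have "f (y - of_int l) = (if l = \<lfloor>y\<rfloor> then f (frac y) else 0)" for l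
  proof (cases "l = \<lfloor>y\<rfloor>")
    case True
    then show ?thesis by (simp add: frac_def)
  next
    case False
    then have "l \<ge> \<lfloor>y\<rfloor> + 1 \<or> l \<le> \<lfloor>y\<rfloor> - 1" by auto
    then have "real_of_int l \<ge> real_of_int (\<lfloor>y\<rfloor> + 1) \<or> real_of_int l \<le> real_of_int (\<lfloor>y\<rfloor> - 1)"
      unfolding of_int_le_iff .
    then have "y - of_int l \<le> frac y - 1 \<or> 1 \<le> y - of_int l"
      unfolding frac_def of_int_add of_int_diff of_int_1 using of_int_floor_le[of y] by linarith
    then show ?thesis using False assms(3) by simp
  qed
  then have "(\<Sum>l\<in>{- L - 1..L}. f (y - of_int l)) = (\<Sum>l\<in>{- L - 1..L}. if l = \<lfloor>y\<rfloor> then f (frac y) else 0)"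
    by (intro sum.cong refl)
  then show ?thesis using m by simp
qed

text \<open>On \<open>G\<close>, the coefficient at the integer part of \<open>X x\<close> and row
  \<open>r\<close> starts as 1, all others as 0. One layer makes the initial functions, three serve
  each mask and six the output; \<open>P\<close> is carried through.\<close>

lemma computes_cascade_hat_unit:
  assumes hat: "a < b" "b < c" "1 / 4 \<le> a" "c \<le> 3 / 4"
    and L: "L \<ge> 1" "\<And>j. j \<in> J \<Longrightarrow> \<bar>j\<bar> \<le> L" and re: "r < p" "e < p"
    and P: "computes W d P" "sized m P" "(\<lambda>x. x) \<in> P" "2 * m + 10 * card (offsets L p) + 20 \<le> W"
  shows "computes W (d + 3 * length As + 7)
    (insert (\<lambda>x. cascade J p As (hat a b c) r e (x - \<theta>)) P)"
proof -
  define n where "n = length As"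
  \<comment> \<open>The margin of \<open>frac_power_le\<close>: ramps this short are avoided by all
    inputs in \<open>G\<close>.\<close>
  define \<epsilon> where "\<epsilon> = 1 / (8 * 2 ^ n :: real)"
  have "(8::real) * 2 ^ n \<ge> 1" using one_le_power[of "2::real" n] by linarith
  then have \<epsilon>: "0 < \<epsilon>" "\<epsilon> \<le> 1" unfolding \<epsilon>_def by simp_all
  define X where "X x = x - \<theta>" for x
  define F where "F x = cascade J p As (hat a b c) r e (X x)" for x
  define R where "R = {x. - of_int L - 1 \<le> X x \<and> X x < of_int L + 1}"
  define G where "G = {x \<in> R. frac (2 ^ n * X x) \<le> 7 / 8}"
  define t where "t x = (\<Sum>l\<in>{- L - 1..L}. sawtooth \<epsilon> (X x - of_int l))" for x
  define D where "D x = (\<Sum>l\<in>{- L - 1..L}. tent (X x - of_int l))" for x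
  define q where "q i x = (if snd i = r then pulse \<epsilon> (X x - of_int (fst i)) else 0)"
    for i :: "int \<times> nat" and x
  define S where "S i x = (if snd i = r then sawtooth \<epsilon> (X x - of_int (fst i)) else 0)"
    for i :: "int \<times> nat" and x
  let ?I = "offsets L p"
  have supp0: "hat a b c x = 0" if "x \<le> 1 / 4 \<or> 3 / 4 \<le> x" for x
    using that hat by (intro hat_eq_0) auto
  have L': "\<bar>real_of_int j\<bar> \<le> of_int L" if "j \<in> J" for j
    using L(2)[OF that] by (simp flip: of_int_abs)
  have L1: "real_of_int L \<ge> 1" using L(1) by simp
  have supp: "cascade J p As (hat a b c) s e y = 0" if "\<bar>y\<bar> > of_int L" for s y
  proof (rule cascade_support[OF _ L' that])
    fix x assume "\<bar>x\<bar> > real_of_int L"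
    then have "x \<le> 1 / 4 \<or> 3 / 4 \<le> x" using L1 by linarith
    then show "hat a b c x = 0" by (rule supp0)
  qed
  \<comment> \<open>Off \<open>R\<close> the support bound applies. In \<open>R\<close> off
    \<open>G\<close> the fractional part of \<open>2 ^ n * X x\<close> exceeds 7/8, while a nonzero
    hat value needs it between 1/4 and 3/4.\<close>
  have F0: "F x = 0" if "x \<notin> G" for x
  proof (cases "x \<in> R")
    case False
    then have "\<bar>X x\<bar> > of_int L" unfolding R_def by auto
    then show ?thesis unfolding F_def by (rule supp)
  next
    case True
    then have gt: "frac (2 ^ n * X x) > 7 / 8" using that unfolding G_def by simp
    have "hat a b c (2 ^ n * X x - of_int i) = 0" for i
    proof (rule ccontr)
      let ?v = "2 ^ n * X x - of_int i"
      assume "hat a b c ?v \<noteq> 0"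
      then have v: "1 / 4 < ?v" "?v < 3 / 4" using supp0 by force+
      then have "frac ?v = ?v" by (simp add: frac_eq)
      moreover have "frac ?v = frac (2 ^ n * X x)"
        using frac_add_of_int_right[of "2 ^ n * X x" "- i"] by simp
      ultimately show False using gt v by simp
    qed
    then show ?thesis unfolding F_def n_def by (intro cascade_eq_0)
  qed
  have small: "frac (X x) \<le> 1 - \<epsilon>" if "x \<in> G" for x
    using frac_power_le[of n "X x" 0] that unfolding G_def \<epsilon>_def by simp
  have tG: "t x = frac (X x)" if "x \<in> G" for x
  proof -
    have "t x = sawtooth \<epsilon> (frac (X x))"
      unfolding t_def
      by (rule sum_int_offsets_eq_floor)
        (use that small[OF that] \<epsilon> in \<open>auto simp: G_def R_def intro!: sawtooth_eq(2)\<close>)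
    then show ?thesis using small[OF that] \<epsilon> by (simp add: sawtooth_eq)
  qed
  have D_R: "D x = min (frac (X x)) (1 - frac (X x))" if "x \<in> R" for x
  proof -
    have "D x = tent (frac (X x))"
      unfolding D_def
      by (rule sum_int_offsets_eq_floor)
        (use that frac_lt_1[of "X x"] in \<open>auto simp: R_def intro!: tent_eq(2)\<close>)
    then show ?thesis using frac_lt_1[of "X x"] by (simp add: tent_eq)
  qed
  have D_nR: "D x = 0" if "x \<notin> R" for x
    unfolding D_def
  proof (intro sum.neutral ballI tent_eq(2))
    fix l assume "l \<in> {- L - 1..L}"
    then have "real_of_int (- L - 1) \<le> of_int l" "real_of_int l \<le> of_int L"
      unfolding of_int_le_iff by auto
    then show "X x - of_int l \<le> 0 \<or> 1 \<le> X x - of_int l" using that unfolding R_def by auto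
  qed
  \<comment> \<open>On \<open>G\<close> every shift other than the integer part lands beyond the
    ramps, where \<open>pulse\<close> and \<open>sawtooth\<close> vanish.\<close>
  have cases: "(0 \<le> X x - of_int l \<and> X x - of_int l \<le> 1 - \<epsilon> \<and> X x - of_int l = frac (X x))
      \<or> X x - of_int l \<le> - \<epsilon> \<or> 1 \<le> X x - of_int l" if "x \<in> G" for x l
  proof -
    consider "l = \<lfloor>X x\<rfloor>" | "\<lfloor>X x\<rfloor> + 1 \<le> l" | "l \<le> \<lfloor>X x\<rfloor> - 1" by linarith
    then show ?thesis
    proof cases
      case 1
      then show ?thesis using small[OF that] by (simp add: frac_def)
    next
      case 2
      then have "real_of_int (\<lfloor>X x\<rfloor> + 1) \<le> of_int l" by (simp only: of_int_le_iff)
      then have "X x - of_int l \<le> - \<epsilon>" using small[OF that] unfolding frac_def by simp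
      then show ?thesis by blast
    next
      case 3
      then have "of_int l \<le> real_of_int (\<lfloor>X x\<rfloor> - 1)" by (simp only: of_int_le_iff)
      then have "1 \<le> X x - of_int l" using of_int_floor_le[of "X x"] unfolding of_int_diff by linarith
      then show ?thesis by blast
    qed
  qed
  have qS: "S i x = t x * q i x \<and> \<bar>q i x\<bar> \<le> 1" if "x \<in> G" for x i
    using cases[OF that, of "fst i"] tG[OF that] \<epsilon> pulse_eq[OF \<epsilon>] sawtooth_eq[OF \<epsilon>]
    unfolding q_def S_def by auto
  have FG: "F x = (\<Sum>i\<in>?I. q i x * cascade J p As (hat a b c) (snd i) e (t x + of_int (fst i)))"
    if x: "x \<in> G" for x
  proof -
    have m: "\<lfloor>X x\<rfloor> \<in> {- L - 1..L}"
      using x unfolding G_def R_def by (auto simp: le_floor_iff floor_le_iff)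
    have "q i x * cascade J p As (hat a b c) (snd i) e (t x + of_int (fst i))
        = (if i = (\<lfloor>X x\<rfloor>, r) then F x else 0)" for i
    proof (cases "i = (\<lfloor>X x\<rfloor>, r)")
      case True
      have "q i x = 1"
        using True small[OF x] \<epsilon> by (simp add: q_def frac_def pulse_eq)
      moreover have "t x + of_int (fst i) = X x" using True tG[OF x] by (simp add: frac_def)
      ultimately show ?thesis using True by (simp add: F_def)
    next
      case False
      have "q i x = 0"
      proof (cases "snd i = r")
        case True
        then have "fst i \<noteq> \<lfloor>X x\<rfloor>" using False by (auto simp: prod_eq_iff)
        then have "X x - of_int (fst i) \<noteq> frac (X x)" by (simp add: frac_def)
        then show ?thesis using cases[OF x, of "fst i"] \<epsilon> by (auto simp: q_def pulse_eq)
      qed (simp add: q_def)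
      then show ?thesis using False by simp
    qed
    then show ?thesis using m re by (simp add: offsets_def)
  qed
  \<comment> \<open>The constants added in \<open>pulse\<close>, \<open>sawtooth\<close> and
    \<open>tent\<close>, hence at most five neurons per shift.\<close>
  define Cs where "Cs = {0, \<epsilon>, \<epsilon> - 1, - 1, - 1 / 2}"
  define Gs where "Gs = (\<lambda>i x. X x - of_int (fst i) + snd i) ` ({- L - 1..L} \<times> Cs)"
  let ?V = "P \<union> (\<lambda>f x. max (f x) 0) ` Gs"
  have "computes W (Suc d) ?V"
  proof (rule computes_relu[OF P(1,2)])
    show "P \<noteq> {}" using P(3) by auto
    have "finite Cs" by (simp add: Cs_def)
    then show "sized (card ({- L - 1..L} \<times> Cs)) Gs" unfolding Gs_def by (intro sized_image) simp
    have "(\<lambda>x. x) \<in> affine_span P" using P(3) by (rule affine_span.base)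
    then show "Gs \<subseteq> affine_span P" unfolding Gs_def X_def by (auto intro!: affine_span_intros)
    have "card Cs \<le> 5" unfolding Cs_def by (simp add: card_insert_if)
    then have "card ({- L - 1..L} \<times> Cs) \<le> card {- L - 1..L} * 5"
      unfolding card_cartesian_product by (rule mult_le_mono2)
    also have "card {- L - 1..L} \<le> card ?I"
      using re unfolding offsets_def card_cartesian_product by simp
    finally show "2 * m + card ({- L - 1..L} \<times> Cs) \<le> W" using P(4) by linarith
  qed
  then have "computes W (Suc d) (P \<union> {t, D} \<union> q ` ?I \<union> S ` ?I)"
  proof (rule computes_span)
    have b: "(\<lambda>x. max (X x - of_int l + k) 0) \<in> affine_span ?V"
      if "l \<in> {- L - 1..L}" "k \<in> Cs" for l k
      using that unfolding Gs_def image_image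
      by (intro affine_span.base UnI2 image_eqI[of _ _ "(l, k)"]) auto
    have b0: "(\<lambda>x. max (X x - of_int l) 0) \<in> affine_span ?V" if "l \<in> {- L - 1..L}" for l
      using b[OF that, of 0] by (simp add: Cs_def)
    have pl: "(\<lambda>x. pulse \<epsilon> (X x - of_int l)) \<in> affine_span ?V"
      and sw: "(\<lambda>x. sawtooth \<epsilon> (X x - of_int l)) \<in> affine_span ?V"
      and tn: "(\<lambda>x. tent (X x - of_int l)) \<in> affine_span ?V" if "l \<in> {- L - 1..L}" for l
      unfolding pulse_def sawtooth_def tent_def
      by (intro affine_span_intros b[OF that] b0[OF that]; simp add: Cs_def)+
    have "t \<in> affine_span ?V" "D \<in> affine_span ?V"
      unfolding t_def[abs_def] D_def[abs_def] by (intro affine_span_sum sw tn; assumption)+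
    moreover have "q i \<in> affine_span ?V" "S i \<in> affine_span ?V" if "i \<in> ?I" for i
    proof -
      have "fst i \<in> {- L - 1..L}" using that by (auto simp: offsets_def)
      then show "q i \<in> affine_span ?V" "S i \<in> affine_span ?V"
        unfolding q_def[abs_def] S_def[abs_def]
        by - (intro affine_span_if affine_span.const pl sw; assumption)+
    qed
    ultimately show "P \<union> {t, D} \<union> q ` ?I \<union> S ` ?I \<subseteq> affine_span ?V"
      by (auto intro: affine_span.base)
  qed
  then have "computes W (Suc d + 3 * length As + 6) (insert F P)"
    by (intro cascade_network_run[where k = 0 and R = R and G = G and X = X and n = n and B = 1
          and t = t and D = D and q = q and S = S, OF hat L re(2)])
      (use F0 D_R D_nR tG qS FG P(2,4) in \<open>auto simp: n_def[symmetric], auto simp: G_def\<close>)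
  then show ?thesis unfolding F_def[abs_def] X_def by (simp add: algebra_simps)
qed

section \<open>Assembly of all hats\<close>

lemma computes_cascade_hat:
  assumes hat: "a < b" "b < c" "c - a \<le> 1 / 2"
    and L: "L \<ge> 1" "\<And>j. j \<in> J \<Longrightarrow> \<bar>j\<bar> \<le> L" and re: "r < p" "e < p"
    and P: "computes W d P" "sized m P" "(\<lambda>x. x) \<in> P" "2 * m + 10 * card (offsets L p) + 20 \<le> W"
  shows "computes W (d + 3 * length As + 7) (insert (cascade J p As (hat a b c) r e) P)"
proof -
  \<comment> \<open>Moves the left end to 1/4; length at most 1/2 then puts the right end at most at
    3/4. After refinement this translation is divided by \<open>2 ^ length As\<close>.\<close>
  let ?s = "a - 1 / 4"
  have "cascade J p As (hat a b c) r e x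
      = cascade J p As (hat (a - ?s) (b - ?s) (c - ?s)) r e (x - ?s / 2 ^ length As)" for x
    unfolding cascade_translate[symmetric] hat_translate[of a b c _ ?s, symmetric] by simp
  then have "cascade J p As (hat a b c) r e
      = (\<lambda>x. cascade J p As (hat (a - ?s) (b - ?s) (c - ?s)) r e (x - ?s / 2 ^ length As))"
    by (rule ext)
  then show ?thesis
    using computes_cascade_hat_unit[OF _ _ _ _ L re P, where a = "a - ?s" and b = "b - ?s"
        and c = "c - ?s" and As = As and \<theta> = "?s / 2 ^ length As"] hat by simp
qed

text \<open>The hats are handled one after another, with the input and earlier results carried
  along, so their number multiplies the depth. \<open>sized\<close> is proved alongside because each
  stage needs the count of carried functions.\<close>

lemma computes_cascade_hats:
  assumes "L \<ge> 1" "\<And>j. j \<in> J \<Longrightarrow> \<bar>j\<bar> \<le> L"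
    and "\<forall>(r, e, a, b, c)\<in>set ts. r < p \<and> e < p \<and> a < b \<and> b < c \<and> c - a \<le> 1 / 2"
    and "2 * Suc (length ts) + 10 * card (offsets L p) + 20 \<le> W"
  shows "computes W (length ts * (3 * length As + 7))
      (insert (\<lambda>x. x) ((\<lambda>(r, e, a, b, c). cascade J p As (hat a b c) r e) ` set ts))
    \<and> sized (Suc (length ts))
      (insert (\<lambda>x. x) ((\<lambda>(r, e, a, b, c). cascade J p As (hat a b c) r e) ` set ts))"
  using assms(3,4)
proof (induction ts)
  case Nil
  then show ?case using computes_id by (simp add: sized_def)
next
  case (Cons h ts)
  obtain r e a b c where h: "h = (r, e, a, b, c)" by (cases h)
  let ?P = "insert (\<lambda>x. x) ((\<lambda>(r, e, a, b, c). cascade J p As (hat a b c) r e) ` set ts)"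
  have P: "computes W (length ts * (3 * length As + 7)) ?P" "sized (Suc (length ts)) ?P"
    using Cons by auto
  have "computes W (length ts * (3 * length As + 7) + 3 * length As + 7)
      (insert (cascade J p As (hat a b c) r e) ?P)"
    by (rule computes_cascade_hat[OF _ _ _ assms(1,2) _ _ P]) (use Cons.prems h in auto)
  then show ?case
    using sized_insert[OF P(2), of "cascade J p As (hat a b c) r e"] by (simp add: h insert_commute algebra_simps)
qed

theorem theorem3p1:
  fixes p :: nat and J :: "int set" and g :: "real \<Rightarrow> real vec"
  assumes "p \<ge> 1"
    and "finite J"
    and "\<And>x. g x \<in> carrier_vec p"
    and "compactly_supported p g"
    and "continuous_vec_fun p g"
    and "piecewise_linear p g"
  shows "\<exists>(W::real) (C::real). W > 0 \<and> C > 0 \<and>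
    (\<forall>(n::nat) (As :: (int \<Rightarrow> real mat) list).
      n \<ge> 1 \<and> length As = n \<and> (\<forall>A\<in>set As. \<forall>j\<in>J. A j \<in> carrier_mat p p) \<longrightarrow>
      (\<exists>N. net_dims 1 p N \<and>
        (\<forall>x::real. net_eval N (vec 1 (\<lambda>_. x)) = foldr (refinement_op p J) As g x) \<and>
        real (net_width N) \<le> W \<and>
        real (net_depth N) \<le> C * real n \<and>
        real (net_num_params N) \<le> C * real n))"
proof -
  have "\<forall>e. \<exists>hs. e < p \<longrightarrow> (\<forall>(w, a, b, c)\<in>set hs. a < b \<and> b < c \<and> c - a \<le> 1 / 2) \<and>
    (\<forall>x. g x $ e = (\<Sum>(w, a, b, c)\<leftarrow>hs. w * hat a b c x))"
    using seed_hat_decomposition[OF assms(4-6)] by blast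
  from choice[OF this] obtain hs where
    hs: "\<forall>e. e < p \<longrightarrow> (\<forall>(w, a, b, c)\<in>set (hs e). a < b \<and> b < c \<and> c - a \<le> 1 / 2) \<and>
      (\<forall>x. g x $ e = (\<Sum>(w, a, b, c)\<leftarrow>hs e. w * hat a b c x))" ..
  \<comment> \<open>The 1 makes \<open>[- L, L]\<close> contain the support of a normalised hat and
    covers empty \<open>J\<close>.\<close>
  define L where "L = Max (insert 1 (abs ` J))"
  have L: "L \<ge> 1" "\<And>j. j \<in> J \<Longrightarrow> \<bar>j\<bar> \<le> L"
    using assms(2) by (auto simp: L_def)
  \<comment> \<open>One entry per row, component and hat of that component. The weights are left to
    the output layer.\<close>
  define ts where "ts = concat (map (\<lambda>r. concat (map (\<lambda>e.
    map (\<lambda>(w, a, b, c). (r, e, a, b, c)) (hs e)) [0..<p])) [0..<p])"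
  \<comment> \<open>The summand \<open>p\<close> bounds the output dimension for the parameter
    count.\<close>
  define V where "V = 2 * Suc (length ts) + 10 * card (offsets L p) + 20 + p"
  \<comment> \<open>Since \<open>3 * n + 7 \<le> 10 * n\<close>, the depth is at most
    \<open>10 * length ts * n\<close>; \<open>Suc\<close> accounts for the output map, and the
    second factor bounds the entries of one affine map.\<close>
  define C where "C = Suc (10 * length ts) * (V * V + V)"
  have ts: "\<forall>(r, e, a, b, c)\<in>set ts. r < p \<and> e < p \<and> a < b \<and> b < c \<and> c - a \<le> 1 / 2"
  proof clarify
    fix r e a b c assume "(r, e, a, b, c) \<in> set ts"
    then obtain w where w: "r < p" "e < p" "(w, a, b, c) \<in> set (hs e)" unfolding ts_def by auto
    have "\<forall>(w, a, b, c)\<in>set (hs e). a < b \<and> b < c \<and> c - a \<le> 1 / 2" using hs w(2) by simp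
    from bspec[OF this w(3)] show "r < p \<and> e < p \<and> a < b \<and> b < c \<and> c - a \<le> 1 / 2"
      using w by simp
  qed
  have net: "\<exists>N. net_dims 1 p N \<and>
        (\<forall>x::real. net_eval N (vec 1 (\<lambda>_. x)) = foldr (refinement_op p J) As g x) \<and>
        real (net_width N) \<le> real V \<and>
        real (net_depth N) \<le> real C * real n \<and>
        real (net_num_params N) \<le> real C * real n"
    if n: "n \<ge> 1" "length As = n" and As: "\<forall>A\<in>set As. \<forall>j\<in>J. A j \<in> carrier_mat p p" for n As
  proof -
    define S where "S = insert (\<lambda>x. x) ((\<lambda>(r, e, a, b, c). cascade J p As (hat a b c) r e) ` set ts)"
    have S: "computes V (length ts * (3 * n + 7)) S"
      using computes_cascade_hats[OF L ts, where W = V and As = As] n unfolding S_def V_def by auto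
    define f where "f r x = (\<Sum>e<p. \<Sum>h\<leftarrow>hs e. (case h of (w, a, b, c) \<Rightarrow>
      w * cascade J p As (hat a b c) r e x))" for r x
    have f_span: "f r \<in> affine_span S" if r: "r < p" for r
      unfolding f_def[abs_def]
    proof (intro affine_span_sum affine_span_sum_list)
      fix e h assume e: "e \<in> {..<p}" and h: "h \<in> set (hs e)"
      obtain w a b c where h': "h = (w, a, b, c)" by (cases h)
      have "(r, e, a, b, c) \<in> set ts"
        using r e h unfolding ts_def h' by force
      then have "cascade J p As (hat a b c) r e \<in> S" unfolding S_def by force
      then show "(\<lambda>x. case h of (w, a, b, c) \<Rightarrow> w * cascade J p As (hat a b c) r e x) \<in> affine_span S"
        unfolding h' prod.case by (intro affine_span.scale affine_span.base)
    qed
    have "\<exists>N. net_dims 1 p N \<and> net_width N \<le> V \<and> net_depth N = length ts * (3 * n + 7) \<and>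
        (\<forall>x. net_eval N (vec 1 (\<lambda>_. x)) = vec p (\<lambda>i. f i x))"
      by (rule computes_net[OF S f_span])
    then obtain N where N: "net_dims 1 p N" "net_width N \<le> V" "net_depth N = length ts * (3 * n + 7)"
      "\<forall>x. net_eval N (vec 1 (\<lambda>_. x)) = vec p (\<lambda>i. f i x)"
      by (elim exE conjE) (rule that)
    have "foldr (refinement_op p J) As g x = vec p (\<lambda>i. f i x)" for x
    proof
      have c: "foldr (refinement_op p J) As g x \<in> carrier_vec p"
        by (rule foldr_refinement_op_carrier[OF assms(3)])
      then show "dim_vec (foldr (refinement_op p J) As g x) = dim_vec (vec p (\<lambda>i. f i x))" by simp
      fix r assume "r < dim_vec (vec p (\<lambda>i. f i x))"
      then have r: "r < p" by simp
      have "cascade J p As (\<lambda>x. g x $ e) r e x = (\<Sum>h\<leftarrow>hs e. (case h of (w, a, b, c) \<Rightarrow>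
          w * cascade J p As (hat a b c) r e x))" if "e < p" for e
      proof -
        have "(\<lambda>x. g x $ e) = (\<lambda>x. \<Sum>h\<leftarrow>hs e. (case h of (w, a, b, c) \<Rightarrow> w * hat a b c x))"
          using hs that by auto
        then have "cascade J p As (\<lambda>x. g x $ e) r e x
            = (\<Sum>h\<leftarrow>hs e. cascade J p As (\<lambda>x. case h of (w, a, b, c) \<Rightarrow> w * hat a b c x) r e x)"
          by (simp only: cascade_sum_list)
        then show ?thesis by (simp add: case_prod_beta cascade_scale)
      qed
      then show "foldr (refinement_op p J) As g x $ r = vec p (\<lambda>i. f i x) $ r"
        using foldr_refinement_op_eq_cascade[OF assms(3) As r, where x = x] r by (simp add: f_def)
    qed
    moreover have "net_depth N \<le> 10 * length ts * n"
    proof -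
      have "3 * n + 7 \<le> 10 * n" using n(1) by simp
      then have "length ts * (3 * n + 7) \<le> length ts * (10 * n)" by (rule mult_le_mono2)
      then show ?thesis using N(3) by (simp add: algebra_simps)
    qed
    then have "Suc (net_depth N) \<le> Suc (10 * length ts) * n" using n(1) by simp
    then have par: "Suc (net_depth N) * (V * V + V) \<le> C * n"
      unfolding C_def using mult_le_mono1[of "Suc (net_depth N)" _ "V * V + V"]
      by (metis mult.commute mult.left_commute)
    have "net_depth N * 1 \<le> Suc (net_depth N) * (V * V + V)"
      by (intro mult_le_mono) (auto simp: V_def)
    then have "net_depth N \<le> C * n" using par by linarith
    moreover have "net_num_params N \<le> C * n"
    proof -
      have "1 \<le> V" "p \<le> V" unfolding V_def by simp_all
      then show ?thesis using net_num_params_le[OF N(1) _ _ N(2)] par by linarith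
    qed
    ultimately show ?thesis
      using N by (intro exI[of _ N]) (simp flip: of_nat_mult)
  qed
  have "V > 0" by (simp add: V_def)
  then have "C > 0" by (simp add: C_def)
  show ?thesis
  proof (rule exI[of _ "real V"], rule exI[of _ "real C"], intro conjI allI impI)
    show "real V > 0" "real C > 0" using \<open>V > 0\<close> \<open>C > 0\<close> by simp_all
  next
    fix n :: nat and As :: "(int \<Rightarrow> real mat) list"
    assume "n \<ge> 1 \<and> length As = n \<and> (\<forall>A\<in>set As. \<forall>j\<in>J. A j \<in> carrier_mat p p)"
    then have "n \<ge> 1" "length As = n" "\<forall>A\<in>set As. \<forall>j\<in>J. A j \<in> carrier_mat p p" by simp_all
    then show "\<exists>N. net_dims 1 p N \<and>
        (\<forall>x::real. net_eval N (vec 1 (\<lambda>_. x)) = foldr (refinement_op p J) As g x) \<and>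
        real (net_width N) \<le> real V \<and>
        real (net_depth N) \<le> real C * real n \<and>
        real (net_num_params N) \<le> real C * real n" by (rule net)
  qed
qed

end
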